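(* (Fundamental Lemma) Let $S$ be a class of Eichler simple groups which is closed under quotients. Then a finite group $G$ is $S$-Eichler if and only if $G$ has no quotient in $\mathrm{MNEC}(S)$.
   Context: All groups are finite and considered up to isomorphism. $m_{\mathbb{H}}(G)$ is the number of copies of the quaternions $\mathbb{H}=M_1(\mathbb{H})$ in the Wedderburn decomposition of $\mathbb{R}G$. If $G$ has a quotient isomorphic to $H$ (written $G\twoheadrightarrow H$), then $H$ is an Eichler quotient of $G$ (and $G$ an Eichler cover of $H$) if $m_{\mathbb{H}}(G)=m_{\mathbb{H}}(H)$; otherwise $H$ is a non-Eichler quotient of $G$ and $G$ is a non-Eichler cover of $H$. For a class $S$ of finite groups, $G$ is $S$-Eichler if $G$ has an Eichler quotient $H$ for some $H\in S$. A finite group is Eichler simple if it has no proper Eichler quotients. A class $S$ of Eichler simple groups is closed under quotients if, whenever $G\in S$ and $G\twoheadrightarrow H$ with $H$ Eichler simple, then $H\in S$. $G$ is a minimal non-Eichler cover of $H$ if $G$ is a non-Eichler cover of $H$ and, for some quotient map $f:G\twoheadrightarrow H$, $f$ does not factor (as $G\twoheadrightarrow G'\twoheadrightarrow H$) through a map $f':G'\twoheadrightarrow H$ where $G'\not\cong G$ is another non-Eichler cover of $H$. $\mathrm{MNEC}(H)$ is the class of minimal non-Eichler covers of $H$. For a class $S$ of finite groups, $\mathrm{MNEC}(S)$ is the class of groups $G$ such that $G\in \mathrm{MNEC}(H)\setminus S$ for some $H\in S$ and, if $G\twoheadrightarrow G'$ and $G'\in\mathrm{MNEC}(H')\setminus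 S$ for some $H'\in S$, then $G\cong G'$.
   Formalization: The class S is assumed to be nonempty; for the empty class the statement fails, since no group is S-Eichler while MNEC(S) is empty, so no group has a quotient in it. *)

theory Defs
  imports "HOL-Algebra.Coset" "HOL-Algebra.Ideal" "HOL-Algebra.Module" "HOL-Analysis.Product_Vector"
begin

subsection \<open>Real algebras and the Wedderburn decomposition\<close>

text \<open>Elements of the real group algebra are the real-valued functions on \<open>carrier G\<close>, extended by
  zero outside the carrier; multiplication is convolution.\<close>

definition real_group_algebra :: "('a, 'c) monoid_scheme \<Rightarrow> (real, 'a \<Rightarrow> real) module" where
  "real_group_algebra G =
    \<lparr>carrier = {f. \<forall>x. x \<notin> carrier G \<longrightarrow> f x = 0},
     mult = (\<lambda>f g x. \<Sum>(y, z) \<in> {(y, z). y \<in> carrier G \<and> z \<in> carrier G \<and> y \<otimes>\<^bsub>G\<^esub> z = x}. f y * g z),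
     one = (\<lambda>x. if x = \<one>\<^bsub>G\<^esub> then 1 else 0),
     zero = (\<lambda>x. 0),
     add = (\<lambda>f g x. f x + g x),
     smult = (\<lambda>c f x. c * f x)\<rparr>"

text \<open>The tuple \<open>(a, b, c, d)\<close> stands for \<open>a + b i + c j + d k\<close>.\<close>

fun quat_mult :: "real \<times> real \<times> real \<times> real \<Rightarrow> real \<times> real \<times> real \<times> real \<Rightarrow> real \<times> real \<times> real \<times> real" where
  "quat_mult (a1, b1, c1, d1) (a2, b2, c2, d2) =
    (a1 * a2 - b1 * b2 - c1 * c2 - d1 * d2,
     a1 * b2 + b1 * a2 + c1 * d2 - d1 * c2,
     a1 * c2 - b1 * d2 + c1 * a2 + d1 * b2,
     a1 * d2 + b1 * c2 - c1 * b2 + d1 * a2)"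

definition quaternions :: "(real, real \<times> real \<times> real \<times> real) module" where
  "quaternions =
    \<lparr>carrier = UNIV, mult = quat_mult, one = (1, 0, 0, 0), zero = 0, add = (+), smult = (*\<^sub>R)\<rparr>"

text \<open>Isomorphism of real algebras. A bijection that respects multiplication also matches up the
  units, so the \<open>one\<close> fields are not mentioned; this allows \<open>M\<close> or \<open>N\<close> to be a two-sided ideal that
  is an algebra with a unit of its own.\<close>

definition real_algebra_isomorphic ::
    "(real, 'a, 'm) module_scheme \<Rightarrow> (real, 'b, 'n) module_scheme \<Rightarrow> bool" where
  "real_algebra_isomorphic M N \<longleftrightarrow>
    (\<exists>h. bij_betw h (carrier M) (carrier N) \<and>
         (\<forall>x\<in>carrier M. \<forall>y\<in>carrier M. h (x \<oplus>\<^bsub>M\<^esub> y) = h x \<oplus>\<^bsub>N\<^esub> h y) \<and>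
         (\<forall>x\<in>carrier M. \<forall>y\<in>carrier M. h (x \<otimes>\<^bsub>M\<^esub> y) = h x \<otimes>\<^bsub>N\<^esub> h y) \<and>
         (\<forall>c. \<forall>x\<in>carrier M. h (c \<odot>\<^bsub>M\<^esub> x) = c \<odot>\<^bsub>N\<^esub> h x))"

text \<open>\<open>W\<close> is the set of factors of a decomposition of \<open>A\<close> into a direct product of finitely many
  simple rings, each regarded as a two-sided ideal of \<open>A\<close>. Ideals of a direct factor \<open>B\<close> are the same
  as ideals of \<open>A\<close> contained in \<open>B\<close>, so simplicity of \<open>B\<close> is expressed through the latter.\<close>

definition wedderburn_decomposition :: "('a, 'm) ring_scheme \<Rightarrow> 'a set set \<Rightarrow> bool" where
  "wedderburn_decomposition A W \<longleftrightarrow>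
    finite W \<and>
    (\<forall>B\<in>W. ideal B A \<and> B \<noteq> {\<zero>\<^bsub>A\<^esub>} \<and>
           (\<forall>I. ideal I A \<and> I \<subseteq> B \<longrightarrow> I = {\<zero>\<^bsub>A\<^esub>} \<or> I = B)) \<and>
    (\<forall>x\<in>carrier A. \<exists>!b. b \<in> (\<Pi>\<^sub>E B\<in>W. B) \<and> x = (\<Oplus>\<^bsub>A\<^esub>B\<in>W. b B))"

text \<open>For a finite group the decomposition exists and is unique, because the real group algebra is
  semisimple.\<close>

definition wedderburn_components :: "('a, 'c) monoid_scheme \<Rightarrow> ('a \<Rightarrow> real) set set" where
  "wedderburn_components G = (THE W. wedderburn_decomposition (real_group_algebra G) W)"

definition m_quat :: "('a, 'c) monoid_scheme \<Rightarrow> nat" where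
  "m_quat G = card {B \<in> wedderburn_components G.
     real_algebra_isomorphic ((real_group_algebra G)\<lparr>carrier := B\<rparr>) quaternions}"


subsection \<open>Eichler quotients\<close>

text \<open>Every finite group has isomorphic copies with carrier in \<open>nat\<close>, so classes of finite groups up
  to isomorphism are rendered as sets of type \<open>nat monoid set\<close>, and quantifiers over all finite groups
  range over \<open>nat monoid\<close>.\<close>

definition finite_grp :: "('a, 'c) monoid_scheme \<Rightarrow> bool" where
  "finite_grp G \<longleftrightarrow> group G \<and> finite (carrier G)"

definition has_quotient ::
    "('a, 'c) monoid_scheme \<Rightarrow> ('b, 'd) monoid_scheme \<Rightarrow> bool" (infix \<open>\<twoheadrightarrow>\<close> 60) where
  "G \<twoheadrightarrow> H \<longleftrightarrow> epi G H \<noteq> {}"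

definition eichler_quotient ::
    "('b, 'd) monoid_scheme \<Rightarrow> ('a, 'c) monoid_scheme \<Rightarrow> bool" where
  "eichler_quotient H G \<longleftrightarrow> G \<twoheadrightarrow> H \<and> m_quat G = m_quat H"

definition non_eichler_cover ::
    "('a, 'c) monoid_scheme \<Rightarrow> ('b, 'd) monoid_scheme \<Rightarrow> bool" where
  "non_eichler_cover G H \<longleftrightarrow> G \<twoheadrightarrow> H \<and> m_quat G \<noteq> m_quat H"

definition S_eichler :: "nat monoid set \<Rightarrow> ('a, 'c) monoid_scheme \<Rightarrow> bool" where
  "S_eichler S G \<longleftrightarrow> (\<exists>H\<in>S. eichler_quotient H G)"

text \<open>A quotient \<open>H\<close> of a finite group \<open>G\<close> is proper iff it is not isomorphic to \<open>G\<close>.\<close>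

definition eichler_simple :: "('a, 'c) monoid_scheme \<Rightarrow> bool" where
  "eichler_simple G \<longleftrightarrow>
    (\<forall>H :: nat monoid. finite_grp H \<and> eichler_quotient H G \<longrightarrow> G \<cong> H)"

text \<open>Since \<open>G \<twoheadrightarrow> H\<close> holds for isomorphic groups, this includes closure under isomorphism.\<close>

definition closed_under_quotients :: "nat monoid set \<Rightarrow> bool" where
  "closed_under_quotients S \<longleftrightarrow>
    (\<forall>G\<in>S. \<forall>H :: nat monoid. finite_grp H \<and> eichler_simple H \<and> G \<twoheadrightarrow> H \<longrightarrow> H \<in> S)"

definition MNEC :: "nat monoid \<Rightarrow> nat monoid set" where
  "MNEC H = {G. finite_grp G \<and> non_eichler_cover G H \<and>
     (\<exists>f \<in> epi G H.
        \<not> (\<exists>(G' :: nat monoid) g f'.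
             finite_grp G' \<and> \<not> G' \<cong> G \<and> non_eichler_cover G' H \<and>
             g \<in> epi G G' \<and> f' \<in> epi G' H \<and> (\<forall>x\<in>carrier G. f x = f' (g x))))}"

definition MNEC_class :: "nat monoid set \<Rightarrow> nat monoid set" where
  "MNEC_class S = {G. (\<exists>H\<in>S. G \<in> MNEC H - S) \<and>
     (\<forall>G'. \<forall>H'\<in>S. G \<twoheadrightarrow> G' \<and> G' \<in> MNEC H' - S \<longrightarrow> G \<cong> G')}"

end

theory Submission
  imports Defs
begin

text \<open>
  Everything rests on one fact about real group algebras: the quaternion factors of a quotient \<open>H\<close> of
  \<open>G\<close> correspond to those quaternion factors of \<open>G\<close> that consist of functions constant on the fibres
  of \<open>G \<rightarrow> H\<close>. So \<open>m_quat\<close> does not increase along quotients, and \<open>H\<close> is an Eichler quotient exactly if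
  every quaternion factor of \<open>G\<close> is inflated from \<open>H\<close> (\<open>m_quat_quotient\<close>, \<open>m_quat_quotient_eq_iff\<close>). Let
  \<open>H = G/N\<close> be an Eichler quotient and \<open>Q = G/M\<close> any quotient. The quaternion factors of \<open>G\<close> inflated
  from \<open>Q\<close> are constant on the cosets of both \<open>M\<close> and \<open>N\<close>, so they are inflated from \<open>G/MN\<close>, and this
  common quotient of \<open>H\<close> and \<open>Q\<close> is an Eichler quotient of \<open>Q\<close> (\<open>common_quotient\<close>). To make sense of the
  factors, the Wedderburn decomposition is constructed by elementary means: the orthogonal complement
  of an ideal for the standard inner product on functions is again an ideal, so a largest family of
  pairwise orthogonal nonzero ideals decomposes the algebra, and its members are the minimal ideals.

  Suppose \<open>G\<close> has an Eichler quotient \<open>H \<in> S\<close> and a quotient \<open>Q\<close> that is a minimal non-Eichler cover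
  of a member of \<open>S\<close>. Such a \<open>Q\<close> is Eichler simple (\<open>eichler_simple_MNEC\<close>). The common quotient of \<open>H\<close>
  and \<open>Q\<close> is an Eichler quotient of \<open>Q\<close>, hence isomorphic to \<open>Q\<close>; so \<open>Q\<close> is a quotient of \<open>H\<close> and lies
  in \<open>S\<close>. Hence \<open>G\<close> has no quotient in \<open>MNEC_class S\<close>.

  Conversely, let \<open>G\<close> not be \<open>S\<close>-Eichler and let \<open>Q\<close> be a smallest quotient of \<open>G\<close> that is not. The
  class \<open>S\<close> contains the trivial group, so \<open>Q\<close> has quotients in \<open>S\<close>; let \<open>H\<close> be one with \<open>m_quat H\<close> as
  large as possible. A proper quotient \<open>Q'\<close> of \<open>Q\<close> that covers \<open>H\<close> has, since \<open>Q\<close> is smallest, an Eichler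
  quotient in \<open>S\<close>, so \<open>m_quat Q' \<le> m_quat H\<close> and \<open>Q'\<close> is an Eichler cover of \<open>H\<close>. Thus \<open>Q \<in> MNEC H\<close>
  (\<open>minimal_not_S_eichler_MNEC\<close>), and \<open>Q \<notin> S\<close>. Finally \<open>Q \<in> MNEC_class S\<close>: a proper quotient of \<open>Q\<close> is
  \<open>S\<close>-Eichler, so by the first direction it is not a minimal non-Eichler cover outside \<open>S\<close>.
\<close>

section \<open>Orthogonality of real functions on a finite set\<close>

definition inner_on :: "'a set \<Rightarrow> ('a \<Rightarrow> real) \<Rightarrow> ('a \<Rightarrow> real) \<Rightarrow> real" where
  "inner_on X f g = (\<Sum>x\<in>X. f x * g x)"

lemma inner_on_commute: "inner_on X f g = inner_on X g f"
  by (simp add: inner_on_def mult.commute)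

lemma inner_on_diff_left: "inner_on X (\<lambda>x. f x - g x) h = inner_on X f h - inner_on X g h"
  by (simp add: inner_on_def left_diff_distrib sum_subtractf)

lemma inner_on_add_left: "inner_on X (\<lambda>x. f x + g x) h = inner_on X f h + inner_on X g h"
  by (simp add: inner_on_def distrib_right sum.distrib)

lemma inner_on_scale_left: "inner_on X (\<lambda>x. c * f x) h = c * inner_on X f h"
  by (simp add: inner_on_def sum_distrib_left mult.assoc)

lemma inner_on_scale_right: "inner_on X h (\<lambda>x. c * f x) = c * inner_on X h f"
  by (metis inner_on_commute inner_on_scale_left)

lemma inner_on_sum_left: "inner_on X (\<lambda>x. \<Sum>i\<in>I. f i x) h = (\<Sum>i\<in>I. inner_on X (f i) h)"
  by (simp add: inner_on_def sum_distrib_right) (rule sum.swap)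

lemma inner_on_sum_right: "inner_on X h (\<lambda>x. \<Sum>i\<in>I. f i x) = (\<Sum>i\<in>I. inner_on X h (f i))"
  by (simp add: inner_on_commute[of X h] inner_on_sum_left)

lemma inner_on_self_eq_0:
  assumes "finite X" and "inner_on X f f = 0" and "x \<in> X"
  shows "f x = 0"
  using assms by (simp add: inner_on_def sum_nonneg_eq_0_iff)

lemma inner_on_self_nonneg: "0 \<le> inner_on X f f"
  by (simp add: inner_on_def sum_nonneg)

definition orthonormal_on :: "'a set \<Rightarrow> ('a \<Rightarrow> real) set \<Rightarrow> bool" where
  "orthonormal_on X E \<longleftrightarrow> (\<forall>u\<in>E. \<forall>v\<in>E. inner_on X u v = (if u = v then 1 else 0))"

text \<open>For \<open>x \<in> X\<close> the function \<open>p = (\<Sum>v\<in>E. v x * v)\<close> is the projection of the indicator of \<open>x\<close>,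
  whence \<open>(p x)\<^sup>2 \<le> \<parallel>p\<parallel>\<^sup>2 = p x\<close> and \<open>p x \<le> 1\<close>. Summing \<open>p x = (\<Sum>v\<in>E. (v x)\<^sup>2)\<close> over \<open>x\<close> counts \<open>E\<close>.\<close>

lemma card_orthonormal_on_le:
  assumes X: "finite X" and E: "finite E" and on: "orthonormal_on X E"
  shows "card E \<le> card X"
proof -
  have le1: "(\<Sum>v\<in>E. v x * v x) \<le> 1" if x: "x \<in> X" for x
  proof -
    define p where "p = (\<lambda>z. \<Sum>v\<in>E. v x * v z)"
    have "inner_on X p p = (\<Sum>v\<in>E. v x * (\<Sum>w\<in>E. w x * inner_on X v w))"
      unfolding p_def
      by (simp only: inner_on_sum_left inner_on_sum_right inner_on_scale_left inner_on_scale_right)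
        (simp only: sum_distrib_left)
    also have "\<dots> = (\<Sum>v\<in>E. v x * (\<Sum>w\<in>E. if v = w then w x else 0))"
      using on unfolding orthonormal_on_def by (intro sum.cong arg_cong2[where f = times] refl) auto
    also have "\<dots> = p x"
      by (simp add: p_def E)
    finally have pp: "inner_on X p p = p x" .
    have "p x * p x \<le> inner_on X p p"
      unfolding inner_on_def using x X by (intro member_le_sum) auto
    with pp have "p x * p x \<le> p x * 1" by simp
    then have "p x \<le> 1"
      using mult_strict_left_mono[of 1 "p x" "p x"] by (cases "p x \<le> 1") auto
    then show ?thesis by (simp add: p_def)
  qed
  have "real (card E) = (\<Sum>v\<in>E. inner_on X v v)"
    using on by (simp add: orthonormal_on_def)
  also have "\<dots> = (\<Sum>x\<in>X. \<Sum>v\<in>E. v x * v x)"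
    unfolding inner_on_def by (rule sum.swap)
  also have "\<dots> \<le> (\<Sum>x\<in>X. 1)"
    by (intro sum_mono le1)
  finally show ?thesis by simp
qed

lemma sum_mem_function_space:
  assumes "finite I" and "(\<lambda>x. 0) \<in> V" and "\<And>f g. f \<in> V \<Longrightarrow> g \<in> V \<Longrightarrow> (\<lambda>x. f x + g x) \<in> V"
    and "\<And>i. i \<in> I \<Longrightarrow> f i \<in> V"
  shows "(\<lambda>x. \<Sum>i\<in>I. f i x :: real) \<in> V"
  using assms(1,4) by (induction I rule: finite_induct) (auto intro: assms(2,3))

text \<open>The projection is the Fourier sum over an orthonormal subset of \<open>V\<close> of maximal size; by
  maximality nothing in \<open>V\<close> except zero is orthogonal to that subset.\<close>

lemma orthogonal_projection_exists:
  fixes V :: "('a \<Rightarrow> real) set"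
  assumes X: "finite X"
    and zero: "(\<lambda>x. 0) \<in> V"
    and add: "\<And>f g. f \<in> V \<Longrightarrow> g \<in> V \<Longrightarrow> (\<lambda>x. f x + g x) \<in> V"
    and scale: "\<And>c f. f \<in> V \<Longrightarrow> (\<lambda>x. c * f x) \<in> V"
  shows "\<exists>p\<in>V. \<forall>w\<in>V. inner_on X (\<lambda>x. v x - p x) w = 0"
proof -
  define P where "P E \<longleftrightarrow> finite E \<and> E \<subseteq> V \<and> orthonormal_on X E" for E
  have "\<exists>E. P E \<and> (\<forall>E'. P E' \<longrightarrow> card E' \<le> card E)"
  proof (rule Lattices_Big.ex_has_greatest_nat)
    show "P {}" by (simp add: P_def orthonormal_on_def)
    show "\<forall>E. P E \<longrightarrow> card E < card X + 1"
      using card_orthonormal_on_le[OF X] by (force simp: P_def)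
  qed
  then obtain E where E: "finite E" "E \<subseteq> V" "orthonormal_on X E"
    and max: "\<And>E'. P E' \<Longrightarrow> card E' \<le> card E"
    by (auto simp: P_def)
  define pr where "pr w = (\<lambda>x. \<Sum>u\<in>E. inner_on X w u * u x)" for w
  have pr_V: "pr w \<in> V" for w
    unfolding pr_def using E by (intro sum_mem_function_space zero add scale) auto
  have pr_E: "inner_on X (pr w) u = inner_on X w u" if u: "u \<in> E" for w u
  proof -
    have "inner_on X (pr w) u = (\<Sum>v\<in>E. inner_on X w v * inner_on X v u)"
      by (simp add: pr_def inner_on_sum_left inner_on_scale_left)
    also have "\<dots> = (\<Sum>v\<in>E. if v = u then inner_on X w u else 0)"
      using E(3) u by (intro sum.cong) (auto simp: orthonormal_on_def)
    finally show ?thesis using E u by simp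
  qed
  have pr_id: "pr w x = w x" if w: "w \<in> V" and x: "x \<in> X" for w x
  proof (rule ccontr)
    assume neq: "pr w x \<noteq> w x"
    \<comment> \<open>The residue \<open>q\<close> of \<open>w\<close>, scaled to length one, enlarges the orthonormal set.\<close>
    define q where "q = (\<lambda>x. w x + (-1) * pr w x)"
    have qV: "q \<in> V" unfolding q_def by (intro add scale w pr_V)
    have qE: "inner_on X q u = 0" if "u \<in> E" for u
      using pr_E[OF that, of w] by (simp add: q_def inner_on_add_left inner_on_scale_left inner_on_diff_left)
    define n where "n = inner_on X q q"
    have "n \<noteq> 0" using inner_on_self_eq_0[OF X _ x, of q] neq by (auto simp: n_def q_def)
    then have n: "n > 0" using inner_on_self_nonneg[of X q] by (simp add: n_def)
    define e where "e = (\<lambda>x. (1 / sqrt n) * q x)"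
    have eV: "e \<in> V" unfolding e_def by (intro scale qV)
    have ee: "inner_on X e e = 1"
      using n unfolding e_def inner_on_scale_left inner_on_scale_right n_def[symmetric]
      by (simp add: field_simps)
    have eE: "inner_on X e u = 0" "inner_on X u e = 0" if "u \<in> E" for u
      using qE[OF that] by (simp_all only: e_def inner_on_scale_left inner_on_scale_right
          inner_on_commute[of X u q] mult_zero_right)
    have "e \<notin> E" using eE ee by fastforce
    have "P (insert e E)"
      using E eV ee eE by (auto simp: P_def orthonormal_on_def)
    from max[OF this] show False using \<open>e \<notin> E\<close> E by simp
  qed
  have "inner_on X (\<lambda>x. v x - pr v x) w = 0" if w: "w \<in> V" for w
  proof -
    have "inner_on X (\<lambda>x. v x - pr v x) w = inner_on X (\<lambda>x. v x - pr v x) (pr w)"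
      unfolding inner_on_def by (intro sum.cong) (simp_all add: pr_id[OF w])
    also have "\<dots> = (\<Sum>u\<in>E. inner_on X w u * inner_on X (\<lambda>x. v x - pr v x) u)"
      by (simp add: pr_def[of w] inner_on_sum_right inner_on_scale_right)
    also have "\<dots> = 0" by (intro sum.neutral) (simp add: inner_on_diff_left pr_E)
    finally show ?thesis .
  qed
  then show ?thesis using pr_V by blast
qed

section \<open>The real group algebra\<close>

locale finite_group = group G for G :: "('a, 'c) monoid_scheme" (structure) +
  assumes finite_carrier: "finite (carrier G)"
begin

abbreviation RG :: "(real, 'a \<Rightarrow> real) module" where
  "RG \<equiv> real_group_algebra G"

lemma carrier_RG_iff: "f \<in> carrier RG \<longleftrightarrow> (\<forall>x. x \<notin> carrier G \<longrightarrow> f x = 0)"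
  by (simp add: real_group_algebra_def)

lemma carrier_RG_eq_0: "f \<in> carrier RG \<Longrightarrow> x \<notin> carrier G \<Longrightarrow> f x = 0"
  by (simp add: carrier_RG_iff)

lemma add_RG: "f \<oplus>\<^bsub>RG\<^esub> g = (\<lambda>x. f x + g x)"
  by (simp add: real_group_algebra_def)

lemma zero_RG: "\<zero>\<^bsub>RG\<^esub> = (\<lambda>x. 0)"
  by (simp add: real_group_algebra_def)

lemma one_RG: "\<one>\<^bsub>RG\<^esub> = (\<lambda>x. if x = \<one> then 1 else 0)"
  by (simp add: real_group_algebra_def)

lemma smult_RG: "c \<odot>\<^bsub>RG\<^esub> f = (\<lambda>x. c * f x)"
  by (simp add: real_group_algebra_def)

lemma mult_RG:
  "f \<otimes>\<^bsub>RG\<^esub> g = (\<lambda>x. if x \<in> carrier G then \<Sum>y\<in>carrier G. f y * g (inv y \<otimes> x) else 0)"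
proof
  fix x
  let ?S = "{(y, z). y \<in> carrier G \<and> z \<in> carrier G \<and> y \<otimes> z = x}"
  have eq: "(f \<otimes>\<^bsub>RG\<^esub> g) x = (\<Sum>(y, z)\<in>?S. f y * g z)"
    by (simp add: real_group_algebra_def)
  show "(f \<otimes>\<^bsub>RG\<^esub> g) x = (if x \<in> carrier G then \<Sum>y\<in>carrier G. f y * g (inv y \<otimes> x) else 0)"
  proof (cases "x \<in> carrier G")
    case True
    have "(\<Sum>(y, z)\<in>?S. f y * g z) = (\<Sum>y\<in>carrier G. f y * g (inv y \<otimes> x))"
      by (rule sum.reindex_bij_witness[where i = "\<lambda>y. (y, inv y \<otimes> x)" and j = fst])
        (use True in \<open>auto simp: m_assoc[symmetric]\<close>)
    then show ?thesis using True by (simp add: eq)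
  next
    case False
    then have "?S = {}" by auto
    then show ?thesis using False by (simp only: eq) simp
  qed
qed

lemma sum_translate: "w \<in> carrier G \<Longrightarrow> (\<Sum>y\<in>carrier G. F (w \<otimes> y)) = (\<Sum>y\<in>carrier G. F y)"
  by (rule sum.reindex_bij_witness[where i = "\<lambda>y. inv w \<otimes> y" and j = "\<lambda>y. w \<otimes> y"])
    (auto simp: m_assoc[symmetric])

lemma sum_inv: "(\<Sum>y\<in>carrier G. F (inv y)) = (\<Sum>y\<in>carrier G. F y)"
  by (rule sum.reindex_bij_witness[where i = "\<lambda>y. inv y" and j = "\<lambda>y. inv y"]) auto

lemma mult_RG_closed: "f \<otimes>\<^bsub>RG\<^esub> g \<in> carrier RG"
  by (simp add: carrier_RG_iff mult_RG)

lemma one_mult_RG: "(\<lambda>x. if x = \<one> then c else 0) \<otimes>\<^bsub>RG\<^esub> f = (\<lambda>x. c * f x)"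
  if "f \<in> carrier RG"
proof
  fix x
  have "(\<Sum>y\<in>carrier G. (if y = \<one> then c else 0) * f (inv y \<otimes> x)) = c * f x"
    if "x \<in> carrier G"
  proof -
    have "(\<Sum>y\<in>carrier G. (if y = \<one> then c else 0) * f (inv y \<otimes> x)) =
      (\<Sum>y\<in>carrier G. if y = \<one> then c * f x else 0)"
      using that by (intro sum.cong) auto
    then show ?thesis by (simp add: finite_carrier)
  qed
  then show "((\<lambda>x. if x = \<one> then c else 0) \<otimes>\<^bsub>RG\<^esub> f) x = c * f x"
    using carrier_RG_eq_0[OF that] by (simp add: mult_RG)
qed

lemma mult_one_RG: "f \<otimes>\<^bsub>RG\<^esub> \<one>\<^bsub>RG\<^esub> = f" if "f \<in> carrier RG"
proof
  fix x
  have "(\<Sum>y\<in>carrier G. f y * (if inv y \<otimes> x = \<one> then 1 else 0)) = f x" if "x \<in> carrier G"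
  proof -
    have "(\<Sum>y\<in>carrier G. f y * (if inv y \<otimes> x = \<one> then 1 else 0)) =
      (\<Sum>y\<in>carrier G. if y = x then f x else 0)"
    proof (intro sum.cong refl)
      fix y assume y: "y \<in> carrier G"
      have "inv y \<otimes> x = \<one> \<longleftrightarrow> y = x"
        using y that by (metis inv_closed inv_equality inv_inv l_inv)
      then show "f y * (if inv y \<otimes> x = \<one> then 1 else 0) = (if y = x then f x else 0)" by simp
    qed
    then show ?thesis using that by (simp add: finite_carrier)
  qed
  then show "(f \<otimes>\<^bsub>RG\<^esub> \<one>\<^bsub>RG\<^esub>) x = f x"
    using carrier_RG_eq_0[OF that] by (simp add: mult_RG one_RG)
qed

lemma mult_RG_assoc: "(f \<otimes>\<^bsub>RG\<^esub> g) \<otimes>\<^bsub>RG\<^esub> h = f \<otimes>\<^bsub>RG\<^esub> (g \<otimes>\<^bsub>RG\<^esub> h)"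
proof
  fix x
  show "((f \<otimes>\<^bsub>RG\<^esub> g) \<otimes>\<^bsub>RG\<^esub> h) x = (f \<otimes>\<^bsub>RG\<^esub> (g \<otimes>\<^bsub>RG\<^esub> h)) x"
  proof (cases "x \<in> carrier G")
    case x: True
    have inner: "(\<Sum>y\<in>carrier G. g (inv w \<otimes> y) * h (inv y \<otimes> x)) =
        (\<Sum>v\<in>carrier G. g v * h (inv v \<otimes> (inv w \<otimes> x)))" if w: "w \<in> carrier G" for w
    proof -
      have "(\<Sum>y\<in>carrier G. g (inv w \<otimes> y) * h (inv y \<otimes> x)) =
          (\<Sum>v\<in>carrier G. g (inv w \<otimes> (w \<otimes> v)) * h (inv (w \<otimes> v) \<otimes> x))"
        by (rule sum_translate[OF w, symmetric])
      also have "\<dots> = (\<Sum>v\<in>carrier G. g v * h (inv v \<otimes> (inv w \<otimes> x)))"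
      proof (rule sum.cong[OF refl])
        fix v assume v: "v \<in> carrier G"
        have "inv w \<otimes> (w \<otimes> v) = v" using v w by (simp add: m_assoc[symmetric])
        moreover have "inv (w \<otimes> v) \<otimes> x = inv v \<otimes> (inv w \<otimes> x)"
          using v w x by (simp add: inv_mult_group m_assoc)
        ultimately show "g (inv w \<otimes> (w \<otimes> v)) * h (inv (w \<otimes> v) \<otimes> x) =
            g v * h (inv v \<otimes> (inv w \<otimes> x))" by simp
      qed
      finally show ?thesis .
    qed
    have "((f \<otimes>\<^bsub>RG\<^esub> g) \<otimes>\<^bsub>RG\<^esub> h) x =
        (\<Sum>y\<in>carrier G. (\<Sum>w\<in>carrier G. f w * (g (inv w \<otimes> y) * h (inv y \<otimes> x))))"
      using x by (simp add: mult_RG sum_distrib_right mult.assoc)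
    also have "\<dots> = (\<Sum>w\<in>carrier G. f w * (\<Sum>y\<in>carrier G. g (inv w \<otimes> y) * h (inv y \<otimes> x)))"
      by (subst sum.swap) (simp add: sum_distrib_left)
    also have "\<dots> = (f \<otimes>\<^bsub>RG\<^esub> (g \<otimes>\<^bsub>RG\<^esub> h)) x"
      using x by (simp add: mult_RG inner)
    finally show ?thesis .
  qed (simp add: mult_RG)
qed

sublocale RG: ring RG
proof (rule ringI)
  show "abelian_group RG"
  proof (rule abelian_groupI)
    fix f assume "f \<in> carrier RG"
    then show "\<exists>g\<in>carrier RG. g \<oplus>\<^bsub>RG\<^esub> f = \<zero>\<^bsub>RG\<^esub>"
      by (intro bexI[of _ "\<lambda>x. - f x"]) (auto simp: carrier_RG_iff add_RG zero_RG)
  qed (auto simp: carrier_RG_iff add_RG zero_RG add.assoc add.commute)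
  show "monoid RG"
    by (rule monoidI)
      (auto simp: mult_RG_closed mult_RG_assoc mult_one_RG one_mult_RG one_RG[symmetric],
       auto simp: one_RG carrier_RG_iff one_mult_RG)
qed (auto simp: mult_RG add_RG fun_eq_iff distrib_left distrib_right sum.distrib)

lemma finsum_RG:
  "finite W \<Longrightarrow> b \<in> W \<rightarrow> carrier RG \<Longrightarrow> (\<Oplus>\<^bsub>RG\<^esub>B\<in>W. b B) = (\<lambda>x. \<Sum>B\<in>W. b B x)"
  by (induction W rule: finite_induct) (simp_all add: RG.finsum_insert zero_RG add_RG Pi_iff)

text \<open>Scaling by \<open>c\<close> is multiplication by \<open>c\<close> times the unit, so ideals are subspaces.\<close>

lemma ideal_RG_scale: "ideal I RG \<Longrightarrow> f \<in> I \<Longrightarrow> (\<lambda>x. c * f x) \<in> I"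
proof -
  assume I: "ideal I RG" and f: "f \<in> I"
  have "(\<lambda>x. if x = \<one> then c else 0) \<otimes>\<^bsub>RG\<^esub> f \<in> I"
    by (intro ideal.I_l_closed[OF I f]) (auto simp: carrier_RG_iff)
  then show ?thesis
    using ideal.Icarr[OF I f] by (simp add: one_mult_RG)
qed

lemma ideal_RG_add: "ideal I RG \<Longrightarrow> f \<in> I \<Longrightarrow> g \<in> I \<Longrightarrow> (\<lambda>x. f x + g x) \<in> I"
  using additive_subgroup.a_closed[OF ideal.axioms(1), of I RG f g] by (simp add: add_RG)

lemma ideal_RG_diff: "ideal I RG \<Longrightarrow> f \<in> I \<Longrightarrow> g \<in> I \<Longrightarrow> (\<lambda>x. f x - g x) \<in> I"
  using ideal_RG_add[of I f "\<lambda>x. (-1) * g x"] ideal_RG_scale[of I g "-1"] by simp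

lemma ideal_RG_zero: "ideal I RG \<Longrightarrow> (\<lambda>x. 0) \<in> I"
  using additive_subgroup.zero_closed[OF ideal.axioms(1), of I RG] by (simp add: zero_RG)

lemma ideal_RG_I:
  assumes "I \<subseteq> carrier RG" "(\<lambda>x. 0) \<in> I"
    and "\<And>f g. f \<in> I \<Longrightarrow> g \<in> I \<Longrightarrow> (\<lambda>x. f x + g x) \<in> I"
    and l: "\<And>a f. a \<in> carrier RG \<Longrightarrow> f \<in> I \<Longrightarrow> a \<otimes>\<^bsub>RG\<^esub> f \<in> I"
    and "\<And>a f. a \<in> carrier RG \<Longrightarrow> f \<in> I \<Longrightarrow> f \<otimes>\<^bsub>RG\<^esub> a \<in> I"
  shows "ideal I RG"
proof (rule idealI)
  have neg: "\<ominus>\<^bsub>RG\<^esub> f \<in> I" if "f \<in> I" for f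
  proof -
    have f: "f \<in> carrier RG" using that assms(1) by blast
    have "(\<ominus>\<^bsub>RG\<^esub> \<one>\<^bsub>RG\<^esub>) \<otimes>\<^bsub>RG\<^esub> f = \<ominus>\<^bsub>RG\<^esub> f"
      using f by (simp add: RG.l_minus)
    then show ?thesis using l[of "\<ominus>\<^bsub>RG\<^esub> \<one>\<^bsub>RG\<^esub>" f] that by simp
  qed
  show "subgroup I (add_monoid RG)"
  proof (rule group.subgroupI)
    show "group (add_monoid RG)" by (rule RG.a_group)
    show "inv\<^bsub>add_monoid RG\<^esub> f \<in> I" if "f \<in> I" for f
      using neg[OF that] by (simp add: a_inv_def)
  qed (use assms in \<open>auto simp: add_RG\<close>)
qed (use assms in \<open>auto intro: RG.ring_axioms\<close>)

section \<open>Orthogonality of ideals\<close>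

abbreviation dot (infix \<open>\<bullet>\<close> 70) where
  "f \<bullet> g \<equiv> inner_on (carrier G) f g"

text \<open>The adjoint of multiplication by \<open>a\<close> is multiplication by this element.\<close>

definition star :: "('a \<Rightarrow> real) \<Rightarrow> ('a \<Rightarrow> real)" where
  "star a = (\<lambda>x. if x \<in> carrier G then a (inv x) else 0)"

lemma star_closed: "star a \<in> carrier RG"
  by (simp add: carrier_RG_iff star_def)

lemma inner_mult_left: "(a \<otimes>\<^bsub>RG\<^esub> f) \<bullet> g = f \<bullet> (star a \<otimes>\<^bsub>RG\<^esub> g)"
proof -
  have "(a \<otimes>\<^bsub>RG\<^esub> f) \<bullet> g = (\<Sum>x\<in>carrier G. \<Sum>y\<in>carrier G. a y * (f (inv y \<otimes> x) * g x))"
    by (simp add: inner_on_def mult_RG sum_distrib_right mult.assoc)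
  also have "\<dots> = (\<Sum>y\<in>carrier G. \<Sum>x\<in>carrier G. a y * (f (inv y \<otimes> x) * g x))"
    by (rule sum.swap)
  also have "\<dots> = (\<Sum>y\<in>carrier G. \<Sum>z\<in>carrier G. a y * (f z * g (y \<otimes> z)))"
  proof (rule sum.cong[OF refl])
    fix y assume y: "y \<in> carrier G"
    have "(\<Sum>x\<in>carrier G. a y * (f (inv y \<otimes> x) * g x)) =
        (\<Sum>z\<in>carrier G. a y * (f (inv y \<otimes> (y \<otimes> z)) * g (y \<otimes> z)))"
      by (rule sum_translate[OF y, symmetric])
    also have "\<dots> = (\<Sum>z\<in>carrier G. a y * (f z * g (y \<otimes> z)))"
      using y by (intro sum.cong) (auto simp: m_assoc[symmetric])
    finally show "(\<Sum>x\<in>carrier G. a y * (f (inv y \<otimes> x) * g x)) =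
        (\<Sum>z\<in>carrier G. a y * (f z * g (y \<otimes> z)))" .
  qed
  also have "\<dots> = (\<Sum>y\<in>carrier G. \<Sum>z\<in>carrier G. a (inv y) * (f z * g (inv y \<otimes> z)))"
    by (rule sum_inv[symmetric])
  also have "\<dots> = (\<Sum>z\<in>carrier G. \<Sum>y\<in>carrier G. a (inv y) * (f z * g (inv y \<otimes> z)))"
    by (rule sum.swap)
  also have "\<dots> = f \<bullet> (star a \<otimes>\<^bsub>RG\<^esub> g)"
    by (simp add: inner_on_def mult_RG sum_distrib_left star_def mult.left_commute)
  finally show ?thesis .
qed

lemma inner_mult_right: "(f \<otimes>\<^bsub>RG\<^esub> a) \<bullet> g = f \<bullet> (g \<otimes>\<^bsub>RG\<^esub> star a)"
proof -
  have "(f \<otimes>\<^bsub>RG\<^esub> a) \<bullet> g = (\<Sum>x\<in>carrier G. \<Sum>y\<in>carrier G. f y * (g x * a (inv y \<otimes> x)))"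
    by (simp add: inner_on_def mult_RG sum_distrib_left mult_ac)
  also have "\<dots> = (\<Sum>y\<in>carrier G. \<Sum>x\<in>carrier G. f y * (g x * a (inv y \<otimes> x)))"
    by (rule sum.swap)
  also have "\<dots> = f \<bullet> (g \<otimes>\<^bsub>RG\<^esub> star a)"
    by (simp add: inner_on_def mult_RG sum_distrib_left star_def inv_mult_group)
  finally show ?thesis .
qed

definition orth :: "('a \<Rightarrow> real) set \<Rightarrow> ('a \<Rightarrow> real) set" where
  "orth U = {f \<in> carrier RG. \<forall>u\<in>U. f \<bullet> u = 0}"

lemma inner_self_eq_0_iff: "f \<in> carrier RG \<Longrightarrow> f \<bullet> f = 0 \<longleftrightarrow> f = (\<lambda>x. 0)"
proof
  assume f: "f \<in> carrier RG" "f \<bullet> f = 0"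
  then have "f x = 0" for x
    by (cases "x \<in> carrier G") (blast intro: inner_on_self_eq_0 finite_carrier carrier_RG_eq_0)+
  then show "f = (\<lambda>x. 0)" by blast
qed (simp add: inner_on_def)

text \<open>Passing to adjoints moves a multiplication from one side of the inner product to the other.\<close>

lemma ideal_orth:
  assumes "\<And>a u. a \<in> carrier RG \<Longrightarrow> u \<in> U \<Longrightarrow> a \<otimes>\<^bsub>RG\<^esub> u \<in> U"
    and "\<And>a u. a \<in> carrier RG \<Longrightarrow> u \<in> U \<Longrightarrow> u \<otimes>\<^bsub>RG\<^esub> a \<in> U"
  shows "ideal (orth U) RG"
proof (rule ideal_RG_I)
  show "(\<lambda>x. f x + g x) \<in> orth U" if "f \<in> orth U" "g \<in> orth U" for f g
    using that by (auto simp: orth_def inner_on_add_left carrier_RG_iff)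
  show "a \<otimes>\<^bsub>RG\<^esub> f \<in> orth U" if "f \<in> orth U" for a f
    using that assms(1)[OF star_closed] by (auto simp: orth_def inner_mult_left mult_RG_closed)
  show "f \<otimes>\<^bsub>RG\<^esub> a \<in> orth U" if "f \<in> orth U" for a f
    using that assms(2)[OF star_closed] by (auto simp: orth_def inner_mult_right mult_RG_closed)
qed (auto simp: orth_def carrier_RG_iff inner_on_def)

lemma ideal_orth_ideal: "ideal I RG \<Longrightarrow> ideal (orth I) RG"
  by (intro ideal_orth) (auto intro: ideal.I_l_closed ideal.I_r_closed)

lemma ideal_projection:
  assumes "ideal I RG"
  shows "\<exists>p\<in>I. \<forall>w\<in>I. (\<lambda>x. v x - p x) \<bullet> w = 0"
  by (rule orthogonal_projection_exists)
    (auto intro: finite_carrier ideal_RG_zero ideal_RG_add ideal_RG_scale assms)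

text \<open>The residue of an element of \<open>B\<close> outside \<open>J\<close> after projection to \<open>J\<close> lies in both ideals.\<close>

lemma ideal_Int_orth_nonzero:
  assumes J: "ideal J RG" and B: "ideal B RG" and sub: "J \<subset> B"
  shows "B \<inter> orth J \<noteq> {\<zero>\<^bsub>RG\<^esub>}"
proof -
  obtain b where b: "b \<in> B" "b \<notin> J" using sub by blast
  obtain p where p: "p \<in> J" "\<forall>w\<in>J. (\<lambda>x. b x - p x) \<bullet> w = 0"
    using ideal_projection[OF J] by blast
  have B': "(\<lambda>x. b x - p x) \<in> B" using b p sub by (intro ideal_RG_diff B) auto
  then have "(\<lambda>x. b x - p x) \<in> B \<inter> orth J"
    using p ideal.Icarr[OF B B'] by (auto simp: orth_def)
  moreover have "(\<lambda>x. b x - p x) \<noteq> \<zero>\<^bsub>RG\<^esub>"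
  proof
    assume "(\<lambda>x. b x - p x) = \<zero>\<^bsub>RG\<^esub>"
    then have "b = p" by (auto simp: zero_RG fun_eq_iff)
    then show False using b p by simp
  qed
  ultimately show ?thesis by blast
qed

end

section \<open>The Wedderburn components are the minimal ideals\<close>

definition minimal_ideal :: "('a, 'm) ring_scheme \<Rightarrow> 'a set \<Rightarrow> bool" where
  "minimal_ideal A B \<longleftrightarrow> ideal B A \<and> B \<noteq> {\<zero>\<^bsub>A\<^esub>} \<and>
    (\<forall>I. ideal I A \<and> I \<subseteq> B \<longrightarrow> I = {\<zero>\<^bsub>A\<^esub>} \<or> I = B)"

text \<open>A minimal ideal \<open>M\<close> that is not a factor meets every factor in zero, hence is annihilated by every
  factor, hence by the unit.\<close>

lemma (in ring) wedderburn_decomposition_eq_minimal_ideals: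
  assumes "wedderburn_decomposition R W"
  shows "W = {B. minimal_ideal R B}"
proof
  have fin: "finite W" and min: "\<And>B. B \<in> W \<Longrightarrow> minimal_ideal R B"
    and dec: "\<And>x. x \<in> carrier R \<Longrightarrow> \<exists>!b. b \<in> (\<Pi>\<^sub>E B\<in>W. B) \<and> x = (\<Oplus>B\<in>W. b B)"
    using assms by (auto simp: wedderburn_decomposition_def minimal_ideal_def)
  show "W \<subseteq> {B. minimal_ideal R B}" using min by blast
  show "{B. minimal_ideal R B} \<subseteq> W"
  proof
    fix M assume "M \<in> {B. minimal_ideal R B}"
    then have M: "ideal M R" "M \<noteq> {\<zero>}" "\<And>I. ideal I R \<Longrightarrow> I \<subseteq> M \<Longrightarrow> I = {\<zero>} \<or> I = M"
      by (auto simp: minimal_ideal_def)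
    show "M \<in> W"
    proof (rule ccontr)
      assume nW: "M \<notin> W"
      have disj: "M \<inter> B = {\<zero>}" if B: "B \<in> W" for B
      proof (rule ccontr)
        have B': "ideal B R" "\<And>I. ideal I R \<Longrightarrow> I \<subseteq> B \<Longrightarrow> I = {\<zero>} \<or> I = B"
          using min[OF B] by (auto simp: minimal_ideal_def)
        assume ne: "M \<inter> B \<noteq> {\<zero>}"
        have id: "ideal (M \<inter> B) R" by (rule i_intersect[OF M(1) B'(1)])
        have "M \<inter> B = M" using M(3)[OF id] ne by blast
        moreover have "M \<inter> B = B" using B'(2)[OF id] ne by blast
        ultimately show False using nW B by simp
      qed
      obtain b where b: "b \<in> (\<Pi>\<^sub>E B\<in>W. B)" and one: "\<one> = (\<Oplus>B\<in>W. b B)"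
        using dec[OF one_closed] by blast
      have bB: "b B \<in> B" if "B \<in> W" for B using b that by blast
      have bc: "b B \<in> carrier R" if "B \<in> W" for B
        using bB[OF that] min[OF that] by (auto simp: minimal_ideal_def intro: ideal.Icarr)
      have "x = \<zero>" if x: "x \<in> M" for x
      proof -
        have xc: "x \<in> carrier R" by (rule ideal.Icarr[OF M(1) x])
        have prod0: "x \<otimes> b B = \<zero>" if B: "B \<in> W" for B
        proof -
          have "x \<otimes> b B \<in> M" by (rule ideal.I_r_closed[OF M(1) x bc[OF B]])
          moreover have "x \<otimes> b B \<in> B"
            using min[OF B] by (auto simp: minimal_ideal_def intro: ideal.I_l_closed bB[OF B] xc)
          ultimately show ?thesis using disj[OF B] by blast
        qed
        have "x = x \<otimes> (\<Oplus>B\<in>W. b B)" using xc by (simp add: one[symmetric])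
        also have "\<dots> = (\<Oplus>B\<in>W. x \<otimes> b B)"
          using fin xc bc by (intro finsum_rdistr) auto
        also have "\<dots> = (\<Oplus>B\<in>W. \<zero>)"
          by (intro finsum_cong') (auto simp: prod0)
        finally show ?thesis by simp
      qed
      moreover have "\<zero> \<in> M" using M(1) by (simp add: additive_subgroup.zero_closed ideal.axioms(1))
      ultimately show False using M(2) by blast
    qed
  qed
qed

context finite_group
begin

definition orthogonal_ideals :: "('a \<Rightarrow> real) set set \<Rightarrow> bool" where
  "orthogonal_ideals W \<longleftrightarrow> finite W \<and> (\<forall>B\<in>W. ideal B RG \<and> B \<noteq> {\<zero>\<^bsub>RG\<^esub>}) \<and>
    (\<forall>B\<in>W. \<forall>C\<in>W. B \<noteq> C \<longrightarrow> (\<forall>b\<in>B. \<forall>c\<in>C. b \<bullet> c = 0))"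

lemma ideal_unit_vector:
  assumes B: "ideal B RG" "B \<noteq> {\<zero>\<^bsub>RG\<^esub>}"
  shows "\<exists>e\<in>B. e \<bullet> e = 1"
proof -
  obtain b where b: "b \<in> B" "b \<noteq> \<zero>\<^bsub>RG\<^esub>"
    using B ideal_RG_zero[OF B(1)] by (auto simp: zero_RG)
  have "b \<bullet> b \<noteq> 0"
    using b ideal.Icarr[OF B(1) b(1)] by (simp add: inner_self_eq_0_iff zero_RG)
  then have "b \<bullet> b > 0" using inner_on_self_nonneg[of "carrier G" b] by simp
  then have "(\<lambda>x. (1 / sqrt (b \<bullet> b)) * b x) \<bullet> (\<lambda>x. (1 / sqrt (b \<bullet> b)) * b x) = 1"
    unfolding inner_on_scale_left inner_on_scale_right by (simp add: field_simps)
  then show ?thesis using ideal_RG_scale[OF B(1) b(1)] by blast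
qed

text \<open>A unit vector from each ideal gives an orthonormal set of functions on \<open>G\<close>.\<close>

lemma card_orthogonal_ideals_le:
  assumes "orthogonal_ideals W"
  shows "card W \<le> card (carrier G)"
proof -
  have "\<forall>B\<in>W. \<exists>e\<in>B. e \<bullet> e = 1"
    using assms ideal_unit_vector by (simp add: orthogonal_ideals_def)
  then obtain e where e: "\<And>B. B \<in> W \<Longrightarrow> e B \<in> B" "\<And>B. B \<in> W \<Longrightarrow> e B \<bullet> e B = 1"
    by metis
  have e0: "e B \<bullet> e C = 0" if "B \<in> W" "C \<in> W" "B \<noteq> C" for B C
    using assms that(3) e(1)[OF that(1)] e(1)[OF that(2)] that(1,2)
    by (simp add: orthogonal_ideals_def)
  have inj: "inj_on e W"
  proof (rule inj_onI, rule ccontr)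
    fix B C assume BC: "B \<in> W" "C \<in> W" "e B = e C" "B \<noteq> C"
    then show False using e0[of B C] e(2)[of C] by simp
  qed
  have "orthonormal_on (carrier G) (e ` W)"
    unfolding orthonormal_on_def using e(2) e0 inj by (auto simp: inj_on_eq_iff)
  then have "card (e ` W) \<le> card (carrier G)"
    using assms by (intro card_orthonormal_on_le finite_carrier) (auto simp: orthogonal_ideals_def)
  then show ?thesis by (simp add: card_image[OF inj])
qed

text \<open>The factors are a largest family of pairwise orthogonal nonzero ideals. The orthogonal complement
  of their union could be added to the family unless it is zero, so they span; a smaller nonzero
  ideal \<open>J\<close> inside a factor \<open>B\<close> would allow \<open>B\<close> to be replaced by \<open>J\<close> and its complement in \<open>B\<close>.\<close>

lemma wedderburn_decomposition_exists: "\<exists>W. wedderburn_decomposition RG W"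
proof -
  have "\<exists>W. orthogonal_ideals W \<and> (\<forall>W'. orthogonal_ideals W' \<longrightarrow> card W' \<le> card W)"
  proof (rule Lattices_Big.ex_has_greatest_nat)
    show "orthogonal_ideals {}" by (simp add: orthogonal_ideals_def)
    show "\<forall>W. orthogonal_ideals W \<longrightarrow> card W < card (carrier G) + 1"
      using card_orthogonal_ideals_le by (simp add: less_Suc_eq_le)
  qed
  then obtain W where W: "orthogonal_ideals W"
    and max: "\<And>W'. orthogonal_ideals W' \<Longrightarrow> card W' \<le> card W" by blast
  have fin: "finite W" and idl: "\<And>B. B \<in> W \<Longrightarrow> ideal B RG" and nz: "\<And>B. B \<in> W \<Longrightarrow> B \<noteq> {\<zero>\<^bsub>RG\<^esub>}"
    and ort: "\<And>B C b c. B \<in> W \<Longrightarrow> C \<in> W \<Longrightarrow> B \<noteq> C \<Longrightarrow> b \<in> B \<Longrightarrow> c \<in> C \<Longrightarrow> b \<bullet> c = 0"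
    using W unfolding orthogonal_ideals_def by blast+
  have carr: "b \<in> carrier RG" if "B \<in> W" "b \<in> B" for b B
    using idl[OF that(1)] that(2) by (rule ideal.Icarr)
  have self_orth: "I = {\<zero>\<^bsub>RG\<^esub>}" if "ideal I RG" "\<And>b c. b \<in> I \<Longrightarrow> c \<in> I \<Longrightarrow> b \<bullet> c = 0" for I
    using that ideal.Icarr[OF that(1)] inner_self_eq_0_iff ideal_RG_zero[OF that(1)]
    by (auto simp: zero_RG)
  \<comment> \<open>A new ideal orthogonal to all the factors must be zero.\<close>
  have orth0: "orth (\<Union>W) = {\<zero>\<^bsub>RG\<^esub>}"
  proof (rule ccontr)
    assume ne: "orth (\<Union>W) \<noteq> {\<zero>\<^bsub>RG\<^esub>}"
    have id: "ideal (orth (\<Union>W)) RG"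
      using idl by (intro ideal_orth) (blast intro: ideal.I_l_closed ideal.I_r_closed)+
    have o1: "f \<bullet> b = 0" "b \<bullet> f = 0" if "f \<in> orth (\<Union>W)" "B \<in> W" "b \<in> B" for f b B
      using that inner_on_commute[of "carrier G" b f] by (auto simp: orth_def)
    have "orth (\<Union>W) \<notin> W" using self_orth[OF id] o1 ne by blast
    moreover have "b \<bullet> c = 0" if "I \<in> insert (orth (\<Union>W)) W" "I' \<in> insert (orth (\<Union>W)) W"
        "I \<noteq> I'" "b \<in> I" "c \<in> I'" for I I' b c
      using that ort[of I I' b c] o1 by auto
    then have "orthogonal_ideals (insert (orth (\<Union>W)) W)"
      using fin idl nz id ne by (simp add: orthogonal_ideals_def)
    then have "card (insert (orth (\<Union>W)) W) \<le> card W" by (rule max)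
    ultimately show False using fin by simp
  qed
  \<comment> \<open>The summand of \<open>x\<close> in a factor is its projection; the remainder is orthogonal to all factors.\<close>
  have spans: "\<exists>b. b \<in> (\<Pi>\<^sub>E B\<in>W. B) \<and> x = (\<Oplus>\<^bsub>RG\<^esub>B\<in>W. b B)" if x: "x \<in> carrier RG" for x
  proof -
    have "\<exists>p\<in>B. \<forall>w\<in>B. (\<lambda>y. x y - p y) \<bullet> w = 0" if "B \<in> W" for B
      by (rule ideal_projection[OF idl[OF that]])
    then obtain p where p: "\<And>B. B \<in> W \<Longrightarrow> p B \<in> B"
      "\<And>B w. B \<in> W \<Longrightarrow> w \<in> B \<Longrightarrow> (\<lambda>y. x y - p B y) \<bullet> w = 0"
      by metis
    define r where "r = (\<lambda>y. x y - (\<Sum>B\<in>W. p B y))"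
    have rc: "r \<in> carrier RG"
      using x carr p(1) by (auto simp: r_def carrier_RG_iff intro!: sum.neutral)
    have "r \<bullet> w = 0" if B: "B \<in> W" and w: "w \<in> B" for B w
    proof -
      have "(\<Sum>C\<in>W. p C \<bullet> w) = (\<Sum>C\<in>W. if C = B then p B \<bullet> w else 0)"
        using ort p(1) B w by (intro sum.cong) auto
      also have "\<dots> = p B \<bullet> w" using fin B by simp
      finally have "r \<bullet> w = x \<bullet> w - p B \<bullet> w"
        by (simp add: r_def inner_on_diff_left inner_on_sum_left)
      then show ?thesis using p(2)[OF B w] by (simp add: inner_on_diff_left)
    qed
    then have "r \<in> orth (\<Union>W)" using rc by (auto simp: orth_def)
    then have "r = (\<lambda>y. 0)" using orth0 by (auto simp: zero_RG)
    then have xs: "x = (\<lambda>y. \<Sum>B\<in>W. p B y)" by (auto simp: r_def fun_eq_iff)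
    have "(\<Oplus>\<^bsub>RG\<^esub>B\<in>W. restrict p W B) = x"
      using fin p(1) carr by (subst finsum_RG) (auto simp: xs)
    moreover have "restrict p W \<in> (\<Pi>\<^sub>E B\<in>W. B)" using p(1) by auto
    ultimately show ?thesis by metis
  qed
  have unique: "b = c" if b: "b \<in> (\<Pi>\<^sub>E B\<in>W. B)" and c: "c \<in> (\<Pi>\<^sub>E B\<in>W. B)"
    and eq: "(\<Oplus>\<^bsub>RG\<^esub>B\<in>W. b B) = (\<Oplus>\<^bsub>RG\<^esub>B\<in>W. c B)" for b c
  proof (rule PiE_ext[OF b c])
    fix B assume B: "B \<in> W"
    have bc: "b C \<in> C" "c C \<in> C" if "C \<in> W" for C using b c that by auto
    define d where "d C = (\<lambda>x. b C x - c C x)" for C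
    have dC: "d C \<in> C" if "C \<in> W" for C
      unfolding d_def using bc[OF that] by (intro ideal_RG_diff idl[OF that])
    have "(\<lambda>x. \<Sum>C\<in>W. b C x) = (\<lambda>x. \<Sum>C\<in>W. c C x)"
      using eq bc carr fin by (subst (asm) (1 2) finsum_RG) auto
    then have "(\<lambda>x. \<Sum>C\<in>W. d C x) = (\<lambda>x. 0)"
      by (simp add: d_def sum_subtractf fun_eq_iff)
    then have "(\<Sum>C\<in>W. d C \<bullet> d B) = (\<lambda>x. 0) \<bullet> d B"
      by (simp add: inner_on_sum_left[symmetric])
    also have "\<dots> = 0" by (simp add: inner_on_def)
    also have "(\<Sum>C\<in>W. d C \<bullet> d B) = (\<Sum>C\<in>W. if C = B then d B \<bullet> d B else 0)"
      using ort dC B by (intro sum.cong) auto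
    also have "\<dots> = d B \<bullet> d B" using fin B by simp
    finally have "d B = (\<lambda>x. 0)"
      using inner_self_eq_0_iff carr[OF B dC[OF B]] by simp
    then show "b B = c B" by (auto simp: d_def fun_eq_iff)
  qed
  have minimal: "J = {\<zero>\<^bsub>RG\<^esub>} \<or> J = B" if B: "B \<in> W" and J: "ideal J RG" "J \<subseteq> B" for B J
  proof (rule ccontr)
    assume "\<not> (J = {\<zero>\<^bsub>RG\<^esub>} \<or> J = B)"
    then have J0: "J \<noteq> {\<zero>\<^bsub>RG\<^esub>}" and JB: "J \<subset> B" using J by auto
    define K where "K = B \<inter> orth J"
    have K: "ideal K RG"
      unfolding K_def by (intro RG.i_intersect idl[OF B] ideal_orth_ideal J)
    have K0: "K \<noteq> {\<zero>\<^bsub>RG\<^esub>}"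
      unfolding K_def by (rule ideal_Int_orth_nonzero[OF J(1) idl[OF B] JB])
    have KB: "K \<subseteq> B" by (simp add: K_def)
    have KJ: "k \<bullet> j = 0" "j \<bullet> k = 0" if "k \<in> K" "j \<in> J" for k j
      using that inner_on_commute[of "carrier G" j k] by (auto simp: K_def orth_def)
    have other: "I \<notin> W - {B}" if "ideal I RG" "I \<noteq> {\<zero>\<^bsub>RG\<^esub>}" "I \<subseteq> B" for I
    proof
      assume "I \<in> W - {B}"
      then have "I = {\<zero>\<^bsub>RG\<^esub>}" using that B by (intro self_orth ort[of I B]) auto
      then show False using that by simp
    qed
    have JK: "J \<noteq> K" using self_orth[OF J(1)] KJ J0 by blast
    have "card W = card (W - {B}) + 1" using fin B by (metis Suc_eq_plus1 card_Suc_Diff1)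
    moreover have "card (insert J (insert K (W - {B}))) = card (W - {B}) + 2"
      using fin other[OF J(1) J0 J(2)] other[OF K K0 KB] JK by simp
    moreover have "orthogonal_ideals (insert J (insert K (W - {B})))"
    proof -
      have oB: "b \<bullet> c = 0" "c \<bullet> b = 0" if "b \<in> B" "I \<in> W - {B}" "c \<in> I" for b c I
        using that B ort[of B I b c] ort[of I B c b] by auto
      have "b \<bullet> c = 0" if II: "I \<in> insert J (insert K (W - {B}))" "I' \<in> insert J (insert K (W - {B}))"
        "I \<noteq> I'" "b \<in> I" "c \<in> I'" for I I' b c
      proof (cases "I \<in> W - {B}")
        case True
        show ?thesis
        proof (cases "I' \<in> W - {B}")
          case True
          then show ?thesis using \<open>I \<in> W - {B}\<close> II ort[of I I' b c] by auto
        next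
          case False
          then have "c \<in> B" using II J(2) KB by auto
          then show ?thesis using oB(2) \<open>I \<in> W - {B}\<close> II by auto
        qed
      next
        case False
        then have I: "I = J \<or> I = K" "b \<in> B" using II J(2) KB by auto
        show ?thesis
        proof (cases "I' \<in> W - {B}")
          case True
          then show ?thesis using oB(1) I II by auto
        next
          case False
          then show ?thesis using KJ I II by auto
        qed
      qed
      moreover have "ideal I RG \<and> I \<noteq> {\<zero>\<^bsub>RG\<^esub>}" if "I \<in> insert J (insert K (W - {B}))" for I
        using that idl nz J(1) J0 K K0 by auto
      ultimately show ?thesis
        using fin unfolding orthogonal_ideals_def by simp
    qed
    then have "card (insert J (insert K (W - {B}))) \<le> card W" by (rule max)
    ultimately show False by simp
  qed
  have "wedderburn_decomposition RG W"
    unfolding wedderburn_decomposition_def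
    using fin idl nz minimal spans unique by (intro conjI ballI allI impI ex_ex1I) (blast, blast, blast, blast, blast, metis)
  then show ?thesis ..
qed

lemma wedderburn_components_eq: "wedderburn_components G = {B. minimal_ideal RG B}"
  and finite_minimal_ideals: "finite {B. minimal_ideal RG B}"
proof -
  obtain W where W: "wedderburn_decomposition RG W"
    using wedderburn_decomposition_exists by blast
  have eq: "W' = {B. minimal_ideal RG B}" if "wedderburn_decomposition RG W'" for W'
    using that by (rule RG.wedderburn_decomposition_eq_minimal_ideals)
  show "wedderburn_components G = {B. minimal_ideal RG B}"
    unfolding wedderburn_components_def using W eq by (metis the_equality)
  have "finite W" using W by (simp add: wedderburn_decomposition_def)
  then show "finite {B. minimal_ideal RG B}" using eq[OF W] by simp
qed

definition quaternion_components :: "('a \<Rightarrow> real) set set" where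
  "quaternion_components =
    {B. minimal_ideal RG B \<and> real_algebra_isomorphic (RG\<lparr>carrier := B\<rparr>) quaternions}"

lemma m_quat_eq: "m_quat G = card quaternion_components"
  by (simp add: m_quat_def quaternion_components_def wedderburn_components_eq)

lemma finite_quaternion_components: "finite quaternion_components"
  using finite_minimal_ideals by (rule finite_subset[rotated]) (auto simp: quaternion_components_def)

end

section \<open>Quaternion components of a quotient\<close>

lemma real_algebra_isomorphic_transport:
  assumes bij: "bij_betw \<phi> (carrier M) (carrier M')"
    and hom: "\<And>x y. x \<in> carrier M \<Longrightarrow> y \<in> carrier M \<Longrightarrow> \<phi> (x \<oplus>\<^bsub>M\<^esub> y) = \<phi> x \<oplus>\<^bsub>M'\<^esub> \<phi> y"
      "\<And>x y. x \<in> carrier M \<Longrightarrow> y \<in> carrier M \<Longrightarrow> \<phi> (x \<otimes>\<^bsub>M\<^esub> y) = \<phi> x \<otimes>\<^bsub>M'\<^esub> \<phi> y"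
      "\<And>c x. x \<in> carrier M \<Longrightarrow> \<phi> (c \<odot>\<^bsub>M\<^esub> x) = c \<odot>\<^bsub>M'\<^esub> \<phi> x"
    and closed: "\<And>x y. x \<in> carrier M \<Longrightarrow> y \<in> carrier M \<Longrightarrow> x \<oplus>\<^bsub>M\<^esub> y \<in> carrier M"
      "\<And>x y. x \<in> carrier M \<Longrightarrow> y \<in> carrier M \<Longrightarrow> x \<otimes>\<^bsub>M\<^esub> y \<in> carrier M"
      "\<And>c x. x \<in> carrier M \<Longrightarrow> c \<odot>\<^bsub>M\<^esub> x \<in> carrier M"
  shows "real_algebra_isomorphic M N \<longleftrightarrow> real_algebra_isomorphic M' N"
proof
  assume "real_algebra_isomorphic M' N"
  then obtain h where h: "bij_betw h (carrier M') (carrier N)"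
    "\<And>x y. x \<in> carrier M' \<Longrightarrow> y \<in> carrier M' \<Longrightarrow> h (x \<oplus>\<^bsub>M'\<^esub> y) = h x \<oplus>\<^bsub>N\<^esub> h y"
    "\<And>x y. x \<in> carrier M' \<Longrightarrow> y \<in> carrier M' \<Longrightarrow> h (x \<otimes>\<^bsub>M'\<^esub> y) = h x \<otimes>\<^bsub>N\<^esub> h y"
    "\<And>c x. x \<in> carrier M' \<Longrightarrow> h (c \<odot>\<^bsub>M'\<^esub> x) = c \<odot>\<^bsub>N\<^esub> h x"
    unfolding real_algebra_isomorphic_def by blast
  have "\<phi> x \<in> carrier M'" if "x \<in> carrier M" for x using bij that by (rule bij_betwE[rule_format])
  then show "real_algebra_isomorphic M N"
    unfolding real_algebra_isomorphic_def
    using bij_betw_trans[OF bij h(1)] by (intro exI[of _ "h \<circ> \<phi>"]) (simp add: hom h)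
next
  assume "real_algebra_isomorphic M N"
  then obtain h where h: "bij_betw h (carrier M) (carrier N)"
    "\<And>x y. x \<in> carrier M \<Longrightarrow> y \<in> carrier M \<Longrightarrow> h (x \<oplus>\<^bsub>M\<^esub> y) = h x \<oplus>\<^bsub>N\<^esub> h y"
    "\<And>x y. x \<in> carrier M \<Longrightarrow> y \<in> carrier M \<Longrightarrow> h (x \<otimes>\<^bsub>M\<^esub> y) = h x \<otimes>\<^bsub>N\<^esub> h y"
    "\<And>c x. x \<in> carrier M \<Longrightarrow> h (c \<odot>\<^bsub>M\<^esub> x) = c \<odot>\<^bsub>N\<^esub> h x"
    unfolding real_algebra_isomorphic_def by blast
  define \<psi> where "\<psi> = inv_into (carrier M) \<phi>"
  have \<psi>\<phi>: "\<psi> (\<phi> x) = x" if "x \<in> carrier M" for x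
    unfolding \<psi>_def using bij_betw_inv_into_left[OF bij that] .
  have im: "carrier M' = \<phi> ` carrier M" using bij by (simp add: bij_betw_def)
  have "bij_betw (h \<circ> \<psi>) (carrier M') (carrier N)"
    unfolding \<psi>_def by (rule bij_betw_trans[OF bij_betw_inv_into[OF bij] h(1)])
  then show "real_algebra_isomorphic M' N"
    unfolding real_algebra_isomorphic_def
    by (intro exI[of _ "h \<circ> \<psi>"]) (simp add: im hom[symmetric] \<psi>\<phi> closed h)
qed

locale finite_group_epi = G: finite_group G + H: finite_group H
  for G :: "('a, 'c) monoid_scheme" and H :: "('b, 'd) monoid_scheme" and f +
  assumes epi: "f \<in> epi G H"
begin

lemma f_image: "f ` carrier G = carrier H"
  and f_closed: "x \<in> carrier G \<Longrightarrow> f x \<in> carrier H"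
  using epi by (auto simp: epi_def hom_def)

sublocale group_hom G H f
  using epi by unfold_locales (auto simp: epi_def)

definition kernel_order :: real where
  "kernel_order = real (card (kernel G H f))"

lemma kernel_order_pos: "kernel_order > 0"
proof -
  have "finite (kernel G H f)" using G.finite_carrier by (auto simp: kernel_def)
  moreover have "\<one>\<^bsub>G\<^esub> \<in> kernel G H f" by (simp add: kernel_def)
  ultimately show ?thesis by (auto simp: kernel_order_def card_gt_0_iff)
qed

lemma card_fibre: "x \<in> carrier G \<Longrightarrow> real (card {y \<in> carrier G. f y = f x}) = kernel_order"
proof -
  assume x: "x \<in> carrier G"
  have "bij_betw (\<lambda>y. inv\<^bsub>G\<^esub> x \<otimes>\<^bsub>G\<^esub> y) {y \<in> carrier G. f y = f x} (kernel G H f)"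
    by (rule bij_betw_byWitness[where f' = "\<lambda>y. x \<otimes>\<^bsub>G\<^esub> y"])
      (use x in \<open>auto simp: kernel_def f_closed G.m_assoc[symmetric]\<close>)
  then show ?thesis by (simp add: kernel_order_def bij_betw_same_card)
qed

lemma sum_over_fibres: "(\<Sum>y\<in>carrier G. F (f y)) = kernel_order * (\<Sum>z\<in>carrier H. F z)"
proof -
  have "(\<Sum>y\<in>carrier G. F (f y)) = (\<Sum>z\<in>carrier H. \<Sum>y\<in>{y \<in> carrier G. f y = z}. F (f y))"
    using sum.image_gen[OF G.finite_carrier, of "\<lambda>y. F (f y)" f] by (simp add: f_image)
  also have "\<dots> = (\<Sum>z\<in>carrier H. kernel_order * F z)"
  proof (rule sum.cong[OF refl])
    fix z assume "z \<in> carrier H"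
    then obtain x where x: "x \<in> carrier G" "z = f x" using f_image by blast
    have "(\<Sum>y\<in>{y \<in> carrier G. f y = z}. F (f y)) = (\<Sum>y\<in>{y \<in> carrier G. f y = z}. F z)"
      by (intro sum.cong) auto
    then show "(\<Sum>y\<in>{y \<in> carrier G. f y = z}. F (f y)) = kernel_order * F z"
      using card_fibre[OF x(1)] x(2) by simp
  qed
  finally show ?thesis by (simp add: sum_distrib_left)
qed

text \<open>Dividing by the order of the kernel makes inflation multiplicative: convolution over \<open>G\<close> counts
  every convolution product over \<open>H\<close> that many times.\<close>

definition inflate :: "('b \<Rightarrow> real) \<Rightarrow> ('a \<Rightarrow> real)" where
  "inflate g = (\<lambda>x. if x \<in> carrier G then g (f x) / kernel_order else 0)"

definition inflated :: "('a \<Rightarrow> real) set" where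
  "inflated = {a \<in> carrier G.RG. \<forall>x\<in>carrier G. \<forall>y\<in>carrier G. f x = f y \<longrightarrow> a x = a y}"

lemma inflatedI:
  "a \<in> carrier G.RG \<Longrightarrow>
    (\<And>x y. x \<in> carrier G \<Longrightarrow> y \<in> carrier G \<Longrightarrow> f x = f y \<Longrightarrow> a x = a y) \<Longrightarrow> a \<in> inflated"
  unfolding inflated_def by blast

lemma inflatedD:
  "a \<in> inflated \<Longrightarrow> x \<in> carrier G \<Longrightarrow> y \<in> carrier G \<Longrightarrow> f x = f y \<Longrightarrow> a x = a y"
  unfolding inflated_def by blast

lemma inflate_mult: "inflate (g \<otimes>\<^bsub>H.RG\<^esub> h) = inflate g \<otimes>\<^bsub>G.RG\<^esub> inflate h"
proof
  fix x
  show "inflate (g \<otimes>\<^bsub>H.RG\<^esub> h) x = (inflate g \<otimes>\<^bsub>G.RG\<^esub> inflate h) x"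
  proof (cases "x \<in> carrier G")
    case True
    define F where "F z = g z * h (inv\<^bsub>H\<^esub> z \<otimes>\<^bsub>H\<^esub> f x) / (kernel_order * kernel_order)" for z
    have "(inflate g \<otimes>\<^bsub>G.RG\<^esub> inflate h) x = (\<Sum>y\<in>carrier G. F (f y))"
      using True by (simp add: G.mult_RG inflate_def F_def)
    also have "\<dots> = kernel_order * (\<Sum>z\<in>carrier H. F z)" by (rule sum_over_fibres)
    also have "\<dots> = inflate (g \<otimes>\<^bsub>H.RG\<^esub> h) x"
      using True kernel_order_pos
      by (simp add: inflate_def F_def H.mult_RG f_closed sum_divide_distrib[symmetric])
    finally show ?thesis by simp
  qed (simp add: inflate_def G.mult_RG)
qed

lemma inflate_add: "inflate (g \<oplus>\<^bsub>H.RG\<^esub> h) = inflate g \<oplus>\<^bsub>G.RG\<^esub> inflate h"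
  by (auto simp: inflate_def G.add_RG H.add_RG add_divide_distrib)

lemma inflate_smult: "inflate (c \<odot>\<^bsub>H.RG\<^esub> g) = c \<odot>\<^bsub>G.RG\<^esub> inflate g"
  by (auto simp: inflate_def G.smult_RG H.smult_RG)

lemma inflate_zero: "inflate \<zero>\<^bsub>H.RG\<^esub> = \<zero>\<^bsub>G.RG\<^esub>"
  by (auto simp: inflate_def G.zero_RG H.zero_RG)

lemma inj_on_inflate: "inj_on inflate (carrier H.RG)"
proof (rule inj_onI)
  fix g h assume gh: "g \<in> carrier H.RG" "h \<in> carrier H.RG" and eq: "inflate g = inflate h"
  show "g = h"
  proof
    fix z show "g z = h z"
    proof (cases "z \<in> carrier H")
      case True
      then obtain x where "x \<in> carrier G" "z = f x" using f_image by blast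
      then show ?thesis using fun_cong[OF eq, of x] kernel_order_pos by (simp add: inflate_def)
    qed (simp add: H.carrier_RG_eq_0 gh)
  qed
qed

lemma inflate_image: "inflate ` carrier H.RG = inflated"
proof
  show "inflate ` carrier H.RG \<subseteq> inflated"
    by (auto simp: inflated_def inflate_def G.carrier_RG_iff)
  show "inflated \<subseteq> inflate ` carrier H.RG"
  proof
    fix a assume a: "a \<in> inflated"
    define s where "s = inv_into (carrier G) f"
    define g where "g = (\<lambda>z. if z \<in> carrier H then kernel_order * a (s z) else 0)"
    have "a = inflate g"
    proof
      fix x show "a x = inflate g x"
      proof (cases "x \<in> carrier G")
        case True
        have fx: "f x \<in> f ` carrier G" using True by blast
        have "s (f x) \<in> carrier G" "f (s (f x)) = f x"
          unfolding s_def using inv_into_into[OF fx] f_inv_into_f[OF fx] by auto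
        then have "a (s (f x)) = a x" using a True unfolding inflated_def by blast
        then show ?thesis using True kernel_order_pos f_closed by (simp add: inflate_def g_def)
      next
        case False
        then show ?thesis using a by (simp add: inflate_def inflated_def G.carrier_RG_eq_0)
      qed
    qed
    moreover have "g \<in> carrier H.RG" by (simp add: g_def H.carrier_RG_iff)
    ultimately show "a \<in> inflate ` carrier H.RG" by blast
  qed
qed

lemma inflated_mult_left:
  assumes "a \<in> inflated"
  shows "b \<otimes>\<^bsub>G.RG\<^esub> a \<in> inflated"
proof (rule inflatedI[OF G.mult_RG_closed])
  fix x y assume xy: "x \<in> carrier G" "y \<in> carrier G" "f x = f y"
  have "a (inv\<^bsub>G\<^esub> w \<otimes>\<^bsub>G\<^esub> x) = a (inv\<^bsub>G\<^esub> w \<otimes>\<^bsub>G\<^esub> y)" if "w \<in> carrier G" for w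
    using xy that by (intro inflatedD[OF assms]) (simp_all only: G.m_closed G.inv_closed hom_mult)
  then show "(b \<otimes>\<^bsub>G.RG\<^esub> a) x = (b \<otimes>\<^bsub>G.RG\<^esub> a) y"
    using xy by (simp add: G.mult_RG)
qed

lemma inflated_mult_right:
  assumes "a \<in> inflated"
  shows "a \<otimes>\<^bsub>G.RG\<^esub> b \<in> inflated"
proof (rule inflatedI[OF G.mult_RG_closed])
  have expand: "(a \<otimes>\<^bsub>G.RG\<^esub> b) x = (\<Sum>w\<in>carrier G. a (x \<otimes>\<^bsub>G\<^esub> w) * b (inv\<^bsub>G\<^esub> w))"
    if x: "x \<in> carrier G" for x
  proof -
    have "(a \<otimes>\<^bsub>G.RG\<^esub> b) x = (\<Sum>y\<in>carrier G. a y * b (inv\<^bsub>G\<^esub> y \<otimes>\<^bsub>G\<^esub> x))"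
      using x by (simp add: G.mult_RG)
    also have "\<dots> = (\<Sum>w\<in>carrier G. a (x \<otimes>\<^bsub>G\<^esub> w) * b (inv\<^bsub>G\<^esub> (x \<otimes>\<^bsub>G\<^esub> w) \<otimes>\<^bsub>G\<^esub> x))"
      by (rule G.sum_translate[OF x, symmetric])
    also have "\<dots> = (\<Sum>w\<in>carrier G. a (x \<otimes>\<^bsub>G\<^esub> w) * b (inv\<^bsub>G\<^esub> w))"
      using x by (intro sum.cong) (auto simp: G.inv_mult_group G.m_assoc)
    finally show ?thesis .
  qed
  fix x y assume xy: "x \<in> carrier G" "y \<in> carrier G" "f x = f y"
  have "a (x \<otimes>\<^bsub>G\<^esub> w) = a (y \<otimes>\<^bsub>G\<^esub> w)" if "w \<in> carrier G" for w
    using xy that by (intro inflatedD[OF assms]) (simp_all only: G.m_closed G.inv_closed hom_mult)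
  then show "(a \<otimes>\<^bsub>G.RG\<^esub> b) x = (a \<otimes>\<^bsub>G.RG\<^esub> b) y"
    using xy by (simp add: expand)
qed

text \<open>The image \<open>e\<close> of the unit of \<open>RH\<close> is the unit of the ideal \<open>inflated\<close>, so multiplication of an
  inflated element by any element of \<open>RG\<close> is multiplication by an inflated one.\<close>

lemma ideal_inflate_image:
  assumes I: "ideal I H.RG"
  shows "ideal (inflate ` I) G.RG"
proof (rule G.ideal_RG_I)
  let ?e = "inflate \<one>\<^bsub>H.RG\<^esub>"
  have Ic: "i \<in> carrier H.RG" if "i \<in> I" for i using I that by (rule ideal.Icarr)
  have e: "?e \<in> inflated" using inflate_image by auto
  have "inflate ` I \<subseteq> inflated" using inflate_image Ic by blast
  then show "inflate ` I \<subseteq> carrier G.RG" by (auto simp: inflated_def)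
  show "(\<lambda>x. 0) \<in> inflate ` I"
    using imageI[OF H.ideal_RG_zero[OF I], of inflate] inflate_zero by (simp add: G.zero_RG H.zero_RG)
  show "(\<lambda>x. a x + b x) \<in> inflate ` I" if ab: "a \<in> inflate ` I" "b \<in> inflate ` I" for a b
  proof -
    obtain i j where ij: "i \<in> I" "j \<in> I" "a = inflate i" "b = inflate j" using ab by blast
    then have "(\<lambda>x. a x + b x) = inflate (i \<oplus>\<^bsub>H.RG\<^esub> j)" by (simp add: inflate_add G.add_RG)
    moreover have "i \<oplus>\<^bsub>H.RG\<^esub> j \<in> I" using H.ideal_RG_add[OF I ij(1,2)] by (simp add: H.add_RG)
    ultimately show ?thesis by blast
  qed
  show "b \<otimes>\<^bsub>G.RG\<^esub> a \<in> inflate ` I" if b: "b \<in> carrier G.RG" and a: "a \<in> inflate ` I" for a b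
  proof -
    obtain i where i: "i \<in> I" "a = inflate i" using a by blast
    obtain j where j: "j \<in> carrier H.RG" "b \<otimes>\<^bsub>G.RG\<^esub> ?e = inflate j"
      using inflated_mult_left[OF e] inflate_image by blast
    have "?e \<otimes>\<^bsub>G.RG\<^esub> a = a" using i Ic by (simp add: inflate_mult[symmetric])
    then have "b \<otimes>\<^bsub>G.RG\<^esub> a = (b \<otimes>\<^bsub>G.RG\<^esub> ?e) \<otimes>\<^bsub>G.RG\<^esub> a"
      by (simp only: G.mult_RG_assoc)
    also have "\<dots> = inflate (j \<otimes>\<^bsub>H.RG\<^esub> i)" by (simp add: j i inflate_mult)
    finally show ?thesis using ideal.I_l_closed[OF I i(1) j(1)] by simp
  qed
  show "a \<otimes>\<^bsub>G.RG\<^esub> b \<in> inflate ` I" if b: "b \<in> carrier G.RG" and a: "a \<in> inflate ` I" for a b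
  proof -
    obtain i where i: "i \<in> I" "a = inflate i" using a by blast
    obtain j where j: "j \<in> carrier H.RG" "?e \<otimes>\<^bsub>G.RG\<^esub> b = inflate j"
      using inflated_mult_right[OF e] inflate_image by blast
    have "a \<otimes>\<^bsub>G.RG\<^esub> ?e = a" using i Ic by (simp add: inflate_mult[symmetric])
    then have "a \<otimes>\<^bsub>G.RG\<^esub> b = a \<otimes>\<^bsub>G.RG\<^esub> (?e \<otimes>\<^bsub>G.RG\<^esub> b)"
      by (simp only: G.mult_RG_assoc[symmetric])
    also have "\<dots> = inflate (i \<otimes>\<^bsub>H.RG\<^esub> j)" by (simp add: j i inflate_mult)
    finally show ?thesis using ideal.I_r_closed[OF I i(1) j(1)] by simp
  qed
qed

text \<open>Together with \<open>ideal_inflate_image\<close> this matches the ideals of \<open>RH\<close> with the ideals of \<open>RG\<close> below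
  \<open>inflated\<close>, which is why minimality can be tested on either side.\<close>

lemma ideal_within_inflated:
  assumes J: "ideal J G.RG" and sub: "J \<subseteq> inflated"
  obtains I where "ideal I H.RG" "J = inflate ` I"
proof
  let ?I = "{g \<in> carrier H.RG. inflate g \<in> J}"
  show "J = inflate ` ?I" using sub inflate_image by auto
  have c: "inflate g \<in> carrier G.RG" if "g \<in> carrier H.RG" for g
    using inflate_image that by (auto simp: inflated_def)
  show "ideal ?I H.RG"
  proof (rule H.ideal_RG_I)
    show "(\<lambda>x. 0) \<in> ?I"
      using inflate_zero G.ideal_RG_zero[OF J] by (simp add: H.carrier_RG_iff G.zero_RG H.zero_RG)
    show "(\<lambda>x. g x + h x) \<in> ?I" if "g \<in> ?I" "h \<in> ?I" for g h
      using that inflate_add[of g h] G.ideal_RG_add[OF J, of "inflate g" "inflate h"]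
      by (auto simp: H.carrier_RG_iff G.add_RG H.add_RG)
    show "a \<otimes>\<^bsub>H.RG\<^esub> g \<in> ?I" if "a \<in> carrier H.RG" "g \<in> ?I" for a g
      using that ideal.I_l_closed[OF J _ c] by (auto simp: inflate_mult)
    show "g \<otimes>\<^bsub>H.RG\<^esub> a \<in> ?I" if "a \<in> carrier H.RG" "g \<in> ?I" for a g
      using that ideal.I_r_closed[OF J _ c] by (auto simp: inflate_mult)
  qed auto
qed

lemma inflate_image_eq_iff:
  "I \<subseteq> carrier H.RG \<Longrightarrow> J \<subseteq> carrier H.RG \<Longrightarrow> inflate ` I = inflate ` J \<longleftrightarrow> I = J"
  by (rule inj_on_image_eq_iff[OF inj_on_inflate])

lemma ideal_subset: "ideal I H.RG \<Longrightarrow> I \<subseteq> carrier H.RG"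
  by (auto intro: ideal.Icarr)

lemma inflate_image_eq_zero_iff:
  "I \<subseteq> carrier H.RG \<Longrightarrow> inflate ` I = {\<zero>\<^bsub>G.RG\<^esub>} \<longleftrightarrow> I = {\<zero>\<^bsub>H.RG\<^esub>}"
  using inflate_image_eq_iff[of I "{\<zero>\<^bsub>H.RG\<^esub>}"] by (simp add: inflate_zero)

lemma minimal_ideal_inflate_iff:
  assumes I: "ideal I H.RG"
  shows "minimal_ideal G.RG (inflate ` I) \<longleftrightarrow> minimal_ideal H.RG I"
proof
  assume M: "minimal_ideal G.RG (inflate ` I)"
  have "J = {\<zero>\<^bsub>H.RG\<^esub>} \<or> J = I" if J: "ideal J H.RG" "J \<subseteq> I" for J
  proof -
    have "inflate ` J = {\<zero>\<^bsub>G.RG\<^esub>} \<or> inflate ` J = inflate ` I"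
      using M ideal_inflate_image[OF J(1)] J(2) unfolding minimal_ideal_def by blast
    then show ?thesis
      using inflate_image_eq_zero_iff[OF ideal_subset[OF J(1)]]
        inflate_image_eq_iff[OF ideal_subset[OF J(1)] ideal_subset[OF I]] by blast
  qed
  then show "minimal_ideal H.RG I"
    using M I inflate_image_eq_zero_iff[OF ideal_subset[OF I]] by (auto simp: minimal_ideal_def)
next
  assume M: "minimal_ideal H.RG I"
  have "J' = {\<zero>\<^bsub>G.RG\<^esub>} \<or> J' = inflate ` I" if J': "ideal J' G.RG" "J' \<subseteq> inflate ` I" for J'
  proof -
    have "J' \<subseteq> inflated" using J'(2) inflate_image ideal_subset[OF I] by blast
    then obtain J where J: "ideal J H.RG" "J' = inflate ` J"
      using ideal_within_inflated[OF J'(1)] by blast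
    have "J \<subseteq> I"
    proof
      fix x assume x: "x \<in> J"
      then obtain y where y: "y \<in> I" "inflate x = inflate y" using J'(2) J(2) by blast
      have "x = y"
        using x y ideal_subset[OF I] ideal_subset[OF J(1)] by (intro inj_onD[OF inj_on_inflate]) auto
      then show "x \<in> I" using y by simp
    qed
    then have "J = {\<zero>\<^bsub>H.RG\<^esub>} \<or> J = I" using M J(1) by (auto simp: minimal_ideal_def)
    then show ?thesis using J(2) inflate_zero by auto
  qed
  then show "minimal_ideal G.RG (inflate ` I)"
    using M ideal_inflate_image[OF I] inflate_image_eq_zero_iff[OF ideal_subset[OF I]]
    by (auto simp: minimal_ideal_def)
qed

lemma real_algebra_isomorphic_inflate_iff:
  assumes I: "ideal I H.RG"
  shows "real_algebra_isomorphic (H.RG\<lparr>carrier := I\<rparr>) N \<longleftrightarrow>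
    real_algebra_isomorphic (G.RG\<lparr>carrier := inflate ` I\<rparr>) N"
proof (rule real_algebra_isomorphic_transport)
  show "bij_betw inflate (carrier (H.RG\<lparr>carrier := I\<rparr>)) (carrier (G.RG\<lparr>carrier := inflate ` I\<rparr>))"
    using inj_on_subset[OF inj_on_inflate ideal_subset[OF I]] by (simp add: bij_betw_def)
qed (use I ideal_subset[OF I] H.ideal_RG_add[OF I] H.ideal_RG_scale[OF I] in
    \<open>auto simp: inflate_add inflate_mult inflate_smult H.add_RG[symmetric] H.smult_RG[symmetric]
      intro: ideal.I_l_closed\<close>)

lemma m_quat_quotient: "m_quat H = card {B \<in> G.quaternion_components. B \<subseteq> inflated}"
proof -
  have "(`) inflate ` H.quaternion_components = {B \<in> G.quaternion_components. B \<subseteq> inflated}"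
  proof (intro equalityI subsetI)
    fix B assume "B \<in> (`) inflate ` H.quaternion_components"
    then obtain I where I: "I \<in> H.quaternion_components" "B = inflate ` I" by blast
    have id: "ideal I H.RG" using I by (simp add: H.quaternion_components_def minimal_ideal_def)
    then show "B \<in> {B \<in> G.quaternion_components. B \<subseteq> inflated}"
      using I minimal_ideal_inflate_iff[OF id] real_algebra_isomorphic_inflate_iff[OF id]
        ideal_subset[OF id] inflate_image
      by (auto simp: H.quaternion_components_def G.quaternion_components_def)
  next
    fix B assume B: "B \<in> {B \<in> G.quaternion_components. B \<subseteq> inflated}"
    then have "ideal B G.RG" "B \<subseteq> inflated"
      by (auto simp: G.quaternion_components_def minimal_ideal_def)
    then obtain I where id: "ideal I H.RG" and BI: "B = inflate ` I"
      by (rule ideal_within_inflated)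
    have "real_algebra_isomorphic (G.RG\<lparr>carrier := inflate ` I\<rparr>) quaternions"
      and "minimal_ideal G.RG (inflate ` I)"
      using B BI by (simp_all add: G.quaternion_components_def)
    then have "I \<in> H.quaternion_components"
      unfolding H.quaternion_components_def minimal_ideal_inflate_iff[OF id]
        real_algebra_isomorphic_inflate_iff[OF id, symmetric] by blast
    then show "B \<in> (`) inflate ` H.quaternion_components" using BI by blast
  qed
  moreover have "inj_on ((`) inflate) H.quaternion_components"
    by (rule inj_onI) (use inflate_image_eq_iff ideal_subset in
      \<open>auto simp: H.quaternion_components_def minimal_ideal_def\<close>)
  ultimately show ?thesis by (metis H.m_quat_eq card_image)
qed

lemma m_quat_quotient_le: "m_quat H \<le> m_quat G"
  unfolding m_quat_quotient G.m_quat_eq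
  by (rule card_mono[OF G.finite_quaternion_components]) auto

lemma m_quat_quotient_eq_iff:
  "m_quat G = m_quat H \<longleftrightarrow> (\<forall>B\<in>G.quaternion_components. B \<subseteq> inflated)"
proof
  let ?S = "{B \<in> G.quaternion_components. B \<subseteq> inflated}"
  assume "m_quat G = m_quat H"
  then have "card ?S = card G.quaternion_components" by (simp add: m_quat_quotient G.m_quat_eq)
  then have "?S = G.quaternion_components"
    by (intro card_subset_eq G.finite_quaternion_components) auto
  then show "\<forall>B\<in>G.quaternion_components. B \<subseteq> inflated" by blast
next
  assume "\<forall>B\<in>G.quaternion_components. B \<subseteq> inflated"
  then have "{B \<in> G.quaternion_components. B \<subseteq> inflated} = G.quaternion_components" by blast
  then show "m_quat G = m_quat H" by (simp add: m_quat_quotient G.m_quat_eq)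
qed

end

section \<open>Quotients of finite groups\<close>

lemma finite_group_if_finite_grp: "finite_grp G \<Longrightarrow> finite_group G"
  by (simp add: finite_grp_def finite_group_def finite_group_axioms_def)

lemma finite_group_epi_if_finite_grp:
  "finite_grp G \<Longrightarrow> finite_grp H \<Longrightarrow> f \<in> epi G H \<Longrightarrow> finite_group_epi G H f"
  by (simp add: finite_group_epi_def finite_group_epi_axioms_def finite_group_if_finite_grp)

lemma has_quotient_I: "f \<in> epi G H \<Longrightarrow> G \<twoheadrightarrow> H"
  by (auto simp: has_quotient_def)

lemma has_quotient_trans: "G \<twoheadrightarrow> H \<Longrightarrow> H \<twoheadrightarrow> K \<Longrightarrow> G \<twoheadrightarrow> K"
  unfolding has_quotient_def using epi_compose by blast

lemma iso_imp_has_quotient: "G \<cong> H \<Longrightarrow> G \<twoheadrightarrow> H"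
  by (auto simp: is_iso_def has_quotient_def iso_iff_mon_epi)

lemma has_quotient_refl: "G \<twoheadrightarrow> G"
  by (rule iso_imp_has_quotient) (rule iso_refl)

lemma m_quat_mono:
  "finite_grp G \<Longrightarrow> finite_grp H \<Longrightarrow> G \<twoheadrightarrow> H \<Longrightarrow> m_quat H \<le> m_quat G"
  using finite_group_epi.m_quat_quotient_le[OF finite_group_epi_if_finite_grp]
  by (auto simp: has_quotient_def)

lemma m_quat_cong:
  assumes "finite_grp G" "finite_grp H" "G \<cong> H"
  shows "m_quat G = m_quat H"
proof -
  have "H \<cong> G" using assms group.iso_sym by (auto simp: finite_grp_def)
  then show ?thesis using assms by (intro antisym m_quat_mono iso_imp_has_quotient)
qed

lemma quotient_same_card_iso:
  assumes "finite_grp G" "G \<twoheadrightarrow> H" "card (carrier G) \<le> card (carrier H)"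
  shows "G \<cong> H"
proof -
  obtain f where f: "f \<in> epi G H" using assms(2) by (auto simp: has_quotient_def)
  have fin: "finite (carrier G)" using assms(1) by (simp add: finite_grp_def)
  have im: "f ` carrier G = carrier H" using f by (simp add: epi_def)
  then have "card (f ` carrier G) = card (carrier G)"
    using card_image_le[OF fin, of f] assms(3) by simp
  then have "inj_on f (carrier G)" by (rule eq_card_imp_inj_on[OF fin])
  then have "f \<in> iso G H" using f im by (auto simp: iso_def epi_def bij_betw_def)
  then show ?thesis by (auto simp: is_iso_def)
qed

lemma epi_inj_on_if_iso:
  assumes "finite_grp G" "f \<in> epi G H" "G \<cong> H"
  shows "inj_on f (carrier G)"
proof -
  have "card (carrier G) = card (carrier H)"
    using assms(3) by (auto simp: is_iso_def iso_def dest: bij_betw_same_card)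
  moreover have "f ` carrier G = carrier H" using assms(2) by (simp add: epi_def)
  ultimately show ?thesis
    using assms(1) by (intro eq_card_imp_inj_on) (simp_all add: finite_grp_def)
qed

text \<open>Quotients are constructed over types of cosets, while the classes of groups in question consist of
  groups on \<open>nat\<close>; this lemma moves the former to the latter.\<close>

lemma finite_grp_nat_copy:
  assumes "finite_grp K"
  obtains K' :: "nat monoid" and h where "finite_grp K'" "h \<in> iso K K'"
proof -
  interpret K: group K using assms by (simp add: finite_grp_def)
  have fin: "finite (carrier K)" using assms by (simp add: finite_grp_def)
  obtain h where h: "bij_betw h (carrier K) {0..<card (carrier K)}"
    using ex_bij_betw_finite_nat[OF fin] by blast
  define s where "s = inv_into (carrier K) h"
  have sh: "s (h x) = x" if "x \<in> carrier K" for x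
    unfolding s_def using bij_betw_inv_into_left[OF h that] .
  define K' where "K' = \<lparr>carrier = {0..<card (carrier K)},
    monoid.mult = (\<lambda>x y. h (s x \<otimes>\<^bsub>K\<^esub> s y)), one = h \<one>\<^bsub>K\<^esub>\<rparr>"
  have iso: "h \<in> iso K K'"
  proof -
    have "h \<in> carrier K \<rightarrow> carrier K'" using h by (auto simp: K'_def bij_betw_def)
    then show ?thesis using h by (auto simp: iso_def hom_def K'_def sh)
  qed
  have "group (K'\<lparr>one := h \<one>\<^bsub>K\<^esub>\<rparr>)" by (rule K.iso_imp_img_group[OF iso])
  then have "group K'" by (simp add: K'_def)
  then have "finite_grp K'" by (simp add: finite_grp_def K'_def)
  then show thesis using iso that by blast
qed

lemma quotient_by_normal_nat:
  assumes G: "finite_grp G" and N: "N \<lhd> G"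
  obtains K :: "nat monoid" and g where "finite_grp K" "g \<in> epi G K" "kernel G K g = N"
proof -
  interpret G: group G using G by (simp add: finite_grp_def)
  interpret N: normal N G by (rule N)
  have "finite_grp (G Mod N)"
    using G N.factorgroup_is_group by (simp add: finite_grp_def carrier_FactGroup)
  then obtain K :: "nat monoid" and h where K: "finite_grp K" and h: "h \<in> iso (G Mod N) K"
    by (rule finite_grp_nat_copy)
  have epi1: "(\<lambda>a. N #>\<^bsub>G\<^esub> a) \<in> epi G (G Mod N)"
    using N.r_coset_hom_Mod by (auto simp: epi_def carrier_FactGroup)
  define g where "g = h \<circ> (\<lambda>a. N #>\<^bsub>G\<^esub> a)"
  have g: "g \<in> epi G K"
    unfolding g_def using epi1 h by (intro epi_compose) (auto simp: iso_iff_mon_epi)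
  interpret h: group_hom "G Mod N" K h
    using h K N.factorgroup_is_group
    by (simp add: group_hom_def group_hom_axioms_def finite_grp_def iso_def)
  have "g x = \<one>\<^bsub>K\<^esub> \<longleftrightarrow> x \<in> N" if x: "x \<in> carrier G" for x
  proof -
    have "g x = \<one>\<^bsub>K\<^esub> \<longleftrightarrow> h (N #>\<^bsub>G\<^esub> x) = h \<one>\<^bsub>G Mod N\<^esub>"
      using h.hom_one by (simp add: g_def)
    also have "\<dots> \<longleftrightarrow> N #>\<^bsub>G\<^esub> x = \<one>\<^bsub>G Mod N\<^esub>"
    proof (rule inj_on_eq_iff)
      show "inj_on h (carrier (G Mod N))" using h by (simp add: iso_def bij_betw_def)
      show "N #>\<^bsub>G\<^esub> x \<in> carrier (G Mod N)" using x by (simp add: carrier_FactGroup)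
      show "\<one>\<^bsub>G Mod N\<^esub> \<in> carrier (G Mod N)" by (rule h.G.one_closed)
    qed
    also have "\<dots> \<longleftrightarrow> x \<in> N"
      using x G.coset_join1[OF _ x N.subgroup_axioms] G.coset_join2[OF x N.subgroup_axioms] by auto
    finally show ?thesis .
  qed
  then have "kernel G K g = N" using N.subset by (auto simp: kernel_def)
  then show thesis using K g that by blast
qed

lemma epi_factor:
  assumes G: "group G" "group H" "group K" and g: "g \<in> epi G K" and f: "f \<in> epi G H"
    and ker: "kernel G K g \<subseteq> kernel G H f"
  obtains f' where "f' \<in> epi K H" "\<And>x. x \<in> carrier G \<Longrightarrow> f x = f' (g x)"
proof -
  interpret G: group G by fact
  interpret g: group_hom G K g
    using G g by (simp add: group_hom_def group_hom_axioms_def epi_def)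
  interpret f: group_hom G H f
    using G f by (simp add: group_hom_def group_hom_axioms_def epi_def)
  define s where "s = inv_into (carrier G) g"
  define f' where "f' = (\<lambda>k. f (s k))"
  have im: "g ` carrier G = carrier K" "f ` carrier G = carrier H" using g f by (auto simp: epi_def)
  have s: "s (g x) \<in> carrier G" "g (s (g x)) = g x" if "x \<in> carrier G" for x
    using inv_into_into[of "g x" g "carrier G"] f_inv_into_f[of "g x" g "carrier G"] that
    by (auto simp: s_def)
  have eq: "f x = f y" if xy: "x \<in> carrier G" "y \<in> carrier G" "g x = g y" for x y
  proof -
    have "x \<otimes>\<^bsub>G\<^esub> inv\<^bsub>G\<^esub> y \<in> kernel G K g" using xy by (simp add: kernel_def)
    then have "f (x \<otimes>\<^bsub>G\<^esub> inv\<^bsub>G\<^esub> y) = \<one>\<^bsub>H\<^esub>" using ker by (auto simp: kernel_def)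
    then have "f x \<otimes>\<^bsub>H\<^esub> inv\<^bsub>H\<^esub> f y = \<one>\<^bsub>H\<^esub>" using xy by simp
    then show ?thesis using xy by (metis f.H.inv_closed f.H.inv_equality f.H.inv_inv f.hom_closed)
  qed
  have f'g: "f' (g x) = f x" if "x \<in> carrier G" for x
    unfolding f'_def using s[OF that] that by (intro eq)
  have "f' \<in> hom K H"
  proof (rule homI)
    fix a b assume "a \<in> carrier K" "b \<in> carrier K"
    then obtain x y where xy: "x \<in> carrier G" "y \<in> carrier G" "a = g x" "b = g y"
      using im(1) by blast
    show "f' a \<in> carrier H" using xy by (simp add: f'g)
    have "a \<otimes>\<^bsub>K\<^esub> b = g (x \<otimes>\<^bsub>G\<^esub> y)" using xy by simp
    then show "f' (a \<otimes>\<^bsub>K\<^esub> b) = f' a \<otimes>\<^bsub>H\<^esub> f' b" using xy by (simp only: f'g G.m_closed f.hom_mult)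
  qed
  moreover have "f' ` carrier K = carrier H"
    unfolding im[symmetric] image_image by (intro image_cong) (simp_all add: f'g)
  ultimately show thesis using f'g by (intro that[of f']) (auto simp: epi_def)
qed

text \<open>\<open>K\<close> is the quotient by the intersection of the two kernels, the smallest quotient of \<open>G\<close> through which
  both \<open>f\<close> and \<open>l\<close> factor.\<close>

lemma quotient_with_smallest_kernel:
  assumes G: "finite_grp G" "group H" "group L" and f: "f \<in> epi G H" and l: "l \<in> epi G L"
  obtains K :: "nat monoid" and g f' l' where "finite_grp K" "g \<in> epi G K" "f' \<in> epi K H" "l' \<in> epi K L"
    "\<And>x. x \<in> carrier G \<Longrightarrow> f x = f' (g x)" "kernel G K g = kernel G H f \<inter> kernel G L l"
proof -
  interpret G: group G using G by (simp add: finite_grp_def)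
  interpret f: group_hom G H f 
    using G f by (simp add: group_hom_def group_hom_axioms_def epi_def finite_grp_def)
  interpret l: group_hom G L l 
    using G l by (simp add: group_hom_def group_hom_axioms_def epi_def finite_grp_def)
  have "kernel G H f \<inter> kernel G L l \<lhd> G"
    by (rule G.normal_subgroup_intersect[OF f.normal_kernel l.normal_kernel])
  then obtain K :: "nat monoid" and g where K: "finite_grp K" "g \<in> epi G K"
    and ker: "kernel G K g = kernel G H f \<inter> kernel G L l"
    by (rule quotient_by_normal_nat[OF G(1)])
  have gK: "group K" using K by (simp add: finite_grp_def)
  obtain f' where f': "f' \<in> epi K H" "\<And>x. x \<in> carrier G \<Longrightarrow> f x = f' (g x)"
    using epi_factor[OF G.group_axioms G(2) gK K(2) f] ker by blast
  obtain l' where l': "l' \<in> epi K L" "\<And>x. x \<in> carrier G \<Longrightarrow> l x = l' (g x)"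
    using epi_factor[OF G.group_axioms G(3) gK K(2) l] ker by blast
  show thesis by (rule that[OF K f'(1) l'(1) f'(2) ker])
qed

text \<open>\<open>K\<close> is the quotient of \<open>G\<close> by the product of the two kernels, taken as the quotient of \<open>H\<close> by the image
  of the kernel of \<open>q\<close>. A function on \<open>G\<close> is inflated from \<open>K\<close> as soon as it is inflated from both \<open>H\<close> and
  \<open>Q\<close>. If \<open>H\<close> is an Eichler quotient, then every quaternion factor is inflated from \<open>H\<close>, so \<open>Q\<close> and \<open>K\<close>
  see the same factors.\<close>

lemma common_quotient:
  assumes G: "finite_grp G" "finite_grp H" "finite_grp Q" and f: "f \<in> epi G H" and q: "q \<in> epi G Q"
  obtains K :: "nat monoid" and u v where "finite_grp K" "u \<in> epi H K" "v \<in> epi Q K"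
    "\<And>x. x \<in> carrier G \<Longrightarrow> u (f x) = v (q x)" "m_quat G = m_quat H \<Longrightarrow> m_quat Q = m_quat K"
proof -
  interpret f: finite_group_epi G H f by (rule finite_group_epi_if_finite_grp[OF G(1,2) f])
  interpret q: finite_group_epi G Q q by (rule finite_group_epi_if_finite_grp[OF G(1,3) q])
  interpret N: normal "kernel G Q q" G by (rule q.normal_kernel)
  have "f ` kernel G Q q \<lhd> H"
    by (rule N.surj_hom_normal_subgroup[OF f.group_hom_axioms f.f_image])
  then obtain K :: "nat monoid" and u where K: "finite_grp K" "u \<in> epi H K"
    and ker: "kernel H K u = f ` kernel G Q q"
    by (rule quotient_by_normal_nat[OF G(2)])
  interpret u: finite_group_epi H K u by (rule finite_group_epi_if_finite_grp[OF G(2) K])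
  have uf: "u \<circ> f \<in> epi G K" by (rule epi_compose[OF f K(2)])
  interpret uf: finite_group_epi G K "u \<circ> f" by (rule finite_group_epi_if_finite_grp[OF G(1) K(1) uf])
  have "kernel G Q q \<subseteq> kernel G K (u \<circ> f)"
  proof
    fix x assume x: "x \<in> kernel G Q q"
    then have "f x \<in> kernel H K u" using ker by blast
    then show "x \<in> kernel G K (u \<circ> f)"
      using x unfolding kernel_def mem_Collect_eq comp_apply by blast
  qed
  then obtain v where v: "v \<in> epi Q K" "\<And>x. x \<in> carrier G \<Longrightarrow> (u \<circ> f) x = v (q x)"
    using epi_factor[OF f.G.group_axioms u.H.group_axioms q.H.group_axioms q uf] by blast
  have "m_quat Q = m_quat K" if m: "m_quat G = m_quat H"
  proof -
    have all: "B \<subseteq> f.inflated" if "B \<in> f.G.quaternion_components" for B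
      using m that f.m_quat_quotient_eq_iff by blast
    have sub1: "uf.inflated \<subseteq> q.inflated"
    proof
      fix a assume a: "a \<in> uf.inflated"
      show "a \<in> q.inflated"
      proof (rule q.inflatedI)
        show "a \<in> carrier f.G.RG" using a by (simp add: uf.inflated_def)
        fix x y assume xy: "x \<in> carrier G" "y \<in> carrier G" "q x = q y"
        then have "(u \<circ> f) x = (u \<circ> f) y" by (simp only: v(2))
        then show "a x = a y" by (rule uf.inflatedD[OF a xy(1,2)])
      qed
    qed
    have sub2: "f.inflated \<inter> q.inflated \<subseteq> uf.inflated"
    proof
      fix a assume a: "a \<in> f.inflated \<inter> q.inflated"
      show "a \<in> uf.inflated"
      proof (rule uf.inflatedI)
        show "a \<in> carrier f.G.RG" using a by (simp add: q.inflated_def)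
        fix x y assume xy: "x \<in> carrier G" "y \<in> carrier G" and eq: "(u \<circ> f) x = (u \<circ> f) y"
        have fxy: "f x \<in> carrier H" "f y \<in> carrier H" by (rule f.f_closed[OF xy(1)] f.f_closed[OF xy(2)])+
        have "u (f x) = u (f y)" using eq unfolding comp_apply .
        then have "u (inv\<^bsub>H\<^esub> f x \<otimes>\<^bsub>H\<^esub> f y) = \<one>\<^bsub>K\<^esub>"
          by (simp only: u.hom_mult u.hom_inv fxy f.H.inv_closed u.hom_closed u.H.l_inv)
        then have "inv\<^bsub>H\<^esub> f x \<otimes>\<^bsub>H\<^esub> f y \<in> kernel H K u"
          unfolding kernel_def using fxy by (blast intro: f.H.m_closed f.H.inv_closed)
        then have "inv\<^bsub>H\<^esub> f x \<otimes>\<^bsub>H\<^esub> f y \<in> f ` kernel G Q q" by (simp only: ker)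
        then obtain n where fn: "inv\<^bsub>H\<^esub> f x \<otimes>\<^bsub>H\<^esub> f y = f n" and ker_n: "n \<in> kernel G Q q"
          by (rule imageE)
        have n: "n \<in> carrier G" "q n = \<one>\<^bsub>Q\<^esub>" using ker_n by (simp_all only: kernel_def mem_Collect_eq)
        have xn: "x \<otimes>\<^bsub>G\<^esub> n \<in> carrier G" using xy(1) n(1) by (rule f.G.m_closed)
        have "f y = f x \<otimes>\<^bsub>H\<^esub> (inv\<^bsub>H\<^esub> f x \<otimes>\<^bsub>H\<^esub> f y)"
          by (simp only: f.H.m_assoc[symmetric] fxy f.H.inv_closed f.H.r_inv f.H.l_one)
        also have "\<dots> = f (x \<otimes>\<^bsub>G\<^esub> n)" by (simp only: fn f.hom_mult xy n(1))
        \<comment> \<open>The product of \<open>x\<close> and \<open>n\<close> has the image of \<open>y\<close> under \<open>f\<close> and the image of \<open>x\<close> under \<open>q\<close>.\<close>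
        finally have "a y = a (x \<otimes>\<^bsub>G\<^esub> n)"
          using a by (intro f.inflatedD[OF _ xy(2) xn]) blast
        also have "\<dots> = a x"
        proof (rule q.inflatedD[OF _ xn xy(1)])
          show "a \<in> q.inflated" using a by blast
          show "q (x \<otimes>\<^bsub>G\<^esub> n) = q x"
            by (simp only: q.hom_mult xy n(1,2) q.hom_closed q.H.r_one)
        qed
        finally show "a x = a y" by simp
      qed
    qed
    have "{B \<in> f.G.quaternion_components. B \<subseteq> q.inflated} =
        {B \<in> f.G.quaternion_components. B \<subseteq> uf.inflated}"
      using all sub1 sub2 by blast
    then show ?thesis using q.m_quat_quotient uf.m_quat_quotient by simp
  qed
  then show thesis using v by (intro that[OF K v(1)]) auto
qed

section \<open>The Fundamental Lemma\<close>

lemma eichler_simple_trivial: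
  assumes G: "finite_grp G" "card (carrier G) = 1"
  shows "eichler_simple G"
  unfolding eichler_simple_def
proof (intro allI impI)
  fix H :: "nat monoid" assume H: "finite_grp H \<and> eichler_quotient H G"
  interpret H: group H using H by (simp add: finite_grp_def)
  have "card (carrier H) \<noteq> 0" using H H.one_closed by (auto simp: finite_grp_def)
  then show "G \<cong> H" using G H by (intro quotient_same_card_iso) (auto simp: eichler_quotient_def)
qed

text \<open>Let \<open>l\<close> map \<open>Q\<close> to an Eichler quotient \<open>L\<close> and let \<open>f\<close> witness the minimality of \<open>Q\<close> over \<open>H\<close>. The
  quotient of \<open>Q\<close> by the intersection of the kernels of \<open>f\<close> and \<open>l\<close> lies above \<open>L\<close>, so it has the same
  \<open>m_quat\<close> as \<open>Q\<close> and is still a non-Eichler cover of \<open>H\<close>; minimality makes that intersection trivial. On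
  the other hand the common quotient of \<open>H\<close> and \<open>L\<close> is an Eichler quotient of the Eichler simple group
  \<open>H\<close>, so it is \<open>H\<close> itself, and the kernel of \<open>l\<close> lies in the kernel of \<open>f\<close>. Thus \<open>l\<close> is injective.\<close>

lemma eichler_simple_MNEC:
  assumes H: "finite_grp H" "eichler_simple H" and Q: "Q \<in> MNEC H"
  shows "eichler_simple Q"
  unfolding eichler_simple_def
proof (intro allI impI)
  fix L :: "nat monoid" assume "finite_grp L \<and> eichler_quotient L Q"
  then have L: "finite_grp L" "Q \<twoheadrightarrow> L" and mL: "m_quat Q = m_quat L"
    by (auto simp: eichler_quotient_def)
  then obtain l where l: "l \<in> epi Q L" by (auto simp: has_quotient_def)
  obtain f where Qf: "finite_grp Q" and mQ: "m_quat Q \<noteq> m_quat H" and f: "f \<in> epi Q H"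
    and min: "\<And>(G' :: nat monoid) g f'. finite_grp G' \<Longrightarrow> non_eichler_cover G' H \<Longrightarrow>
      g \<in> epi Q G' \<Longrightarrow> f' \<in> epi G' H \<Longrightarrow> (\<And>x. x \<in> carrier Q \<Longrightarrow> f x = f' (g x)) \<Longrightarrow> G' \<cong> Q"
    using Q unfolding MNEC_def non_eichler_cover_def by blast
  have grp: "group Q" "group H" "group L" using Qf H L by (auto simp: finite_grp_def)
  have trivial: "x = \<one>\<^bsub>Q\<^esub>" if x: "x \<in> carrier Q" "f x = \<one>\<^bsub>H\<^esub>" "l x = \<one>\<^bsub>L\<^esub>" for x
  proof -
    obtain K :: "nat monoid" and g f' l' where K: "finite_grp K" "g \<in> epi Q K" "f' \<in> epi K H" "l' \<in> epi K L"
      and fg: "\<And>x. x \<in> carrier Q \<Longrightarrow> f x = f' (g x)"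
      and ker: "kernel Q K g = kernel Q H f \<inter> kernel Q L l"
      using quotient_with_smallest_kernel[OF Qf grp(2,3) f l] by blast
    have "m_quat L \<le> m_quat K" "m_quat K \<le> m_quat Q"
      using K L Qf by (auto intro!: m_quat_mono has_quotient_I)
    then have "m_quat K \<noteq> m_quat H" using mL mQ by simp
    then have "K \<cong> Q"
      using K fg by (intro min[of K g f']) (auto simp: non_eichler_cover_def intro: has_quotient_I)
    then have "Q \<cong> K" using K group.iso_sym by (auto simp: finite_grp_def)
    then have "inj_on g (carrier Q)" by (rule epi_inj_on_if_iso[OF Qf K(2)])
    moreover interpret g: group_hom Q K g
      using K grp by (simp add: group_hom_def group_hom_axioms_def epi_def finite_grp_def)
    have "x \<in> kernel Q K g" using x unfolding ker by (simp add: kernel_def)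
    ultimately show ?thesis using g.inj_iff_trivial_ker by blast
  qed
  obtain K :: "nat monoid" and u v where K: "finite_grp K" "u \<in> epi H K" "v \<in> epi L K"
    and uv: "\<And>x. x \<in> carrier Q \<Longrightarrow> u (f x) = v (l x)" and mK: "m_quat H = m_quat K"
    using common_quotient[OF Qf L(1) H(1) l f] mL by metis
  have "H \<cong> K"
    using H(2) K mK by (auto simp: eichler_simple_def eichler_quotient_def intro: has_quotient_I)
  then have inju: "inj_on u (carrier H)" by (rule epi_inj_on_if_iso[OF H(1) K(2)])
  interpret f: finite_group_epi Q H f by (rule finite_group_epi_if_finite_grp[OF Qf H(1) f])
  interpret l: finite_group_epi Q L l by (rule finite_group_epi_if_finite_grp[OF Qf L(1) l])
  interpret u: finite_group_epi H K u by (rule finite_group_epi_if_finite_grp[OF H(1) K(1,2)])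
  interpret v: finite_group_epi L K v by (rule finite_group_epi_if_finite_grp[OF L(1) K(1,3)])
  have "x = \<one>\<^bsub>Q\<^esub>" if x: "x \<in> carrier Q" "l x = \<one>\<^bsub>L\<^esub>" for x
  proof -
    have "u (f x) = u \<one>\<^bsub>H\<^esub>" using x by (simp add: uv)
    then have "f x = \<one>\<^bsub>H\<^esub>"
      by (rule inj_onD[OF inju _ f.f_closed[OF x(1)] f.H.one_closed])
    then show ?thesis using trivial x by blast
  qed
  then have "l \<in> iso Q L" using l.iso_iff l.f_image by blast
  then show "Q \<cong> L" by (auto simp: is_iso_def)
qed

text \<open>The common quotient of \<open>Q\<close> and an Eichler quotient \<open>H \<in> S\<close> of \<open>G\<close> is an Eichler quotient of the Eichler
  simple group \<open>Q\<close>, so \<open>Q\<close> is itself a quotient of \<open>H\<close>.\<close>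

lemma S_eichler_no_MNEC_quotient:
  assumes S: "\<And>H. H \<in> S \<Longrightarrow> finite_grp H \<and> eichler_simple H" and cl: "closed_under_quotients S"
    and G: "finite_grp G" "S_eichler S G" and Q: "Q \<in> MNEC H'" "H' \<in> S" "G \<twoheadrightarrow> Q"
  shows "Q \<in> S"
proof -
  obtain H where H: "H \<in> S" "G \<twoheadrightarrow> H" "m_quat G = m_quat H"
    using G(2) by (auto simp: S_eichler_def eichler_quotient_def)
  have Qf: "finite_grp Q" using Q(1) by (simp add: MNEC_def)
  have Qs: "eichler_simple Q" using S[OF Q(2)] Q(1) by (blast intro: eichler_simple_MNEC)
  obtain f where f: "f \<in> epi G H" using H by (auto simp: has_quotient_def)
  obtain q where q: "q \<in> epi G Q" using Q by (auto simp: has_quotient_def)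
  have Hf: "finite_grp H" using S[OF H(1)] by blast
  obtain K :: "nat monoid" and u v where K: "finite_grp K" "u \<in> epi H K" "v \<in> epi Q K" "m_quat Q = m_quat K"
    using common_quotient[OF G(1) Hf Qf f q] H(3) by metis
  have "Q \<cong> K" using Qs K by (auto simp: eichler_simple_def eichler_quotient_def intro: has_quotient_I)
  then have "K \<twoheadrightarrow> Q" using Qf group.iso_sym by (auto simp: finite_grp_def intro: iso_imp_has_quotient)
  then have "H \<twoheadrightarrow> Q" using K has_quotient_I has_quotient_trans by blast
  then show "Q \<in> S" using cl H(1) Qf Qs by (auto simp: closed_under_quotients_def)
qed

lemma trivial_mem_S:
  assumes S: "\<And>H. H \<in> S \<Longrightarrow> finite_grp H \<and> eichler_simple H" and cl: "closed_under_quotients S"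
    and ne: "S \<noteq> {}" and G: "group G"
  obtains T where "T \<in> S" "G \<twoheadrightarrow> T"
proof -
  define T :: "nat monoid" where "T = \<lparr>carrier = {0}, monoid.mult = (\<lambda>x y. 0), one = 0\<rparr>"
  have "group T" by (rule groupI) (auto simp: T_def)
  then have T: "finite_grp T" by (simp add: finite_grp_def T_def)
  have quot: "K \<twoheadrightarrow> T" if "group K" for K :: "('x, 'y) monoid_scheme"
  proof -
    interpret K: group K by fact
    have "(\<lambda>x. 0) \<in> epi K T"
      using K.one_closed by (auto simp: epi_def hom_def T_def)
    then show ?thesis by (rule has_quotient_I)
  qed
  have "eichler_simple T"
    by (rule eichler_simple_trivial[OF T]) (simp add: T_def)
  moreover obtain H where H: "H \<in> S" using ne by blast
  moreover have "H \<twoheadrightarrow> T" using S[OF H] by (intro quot) (simp add: finite_grp_def)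
  ultimately have "T \<in> S" using cl T by (auto simp: closed_under_quotients_def)
  then show thesis using quot[OF G] that by blast
qed

text \<open>\<open>Q\<close> covers minimally a quotient \<open>H \<in> S\<close> with the largest possible \<open>m_quat H\<close>: a smaller non-Eichler
  cover \<open>G'\<close> of \<open>H\<close> below \<open>Q\<close> would be \<open>S\<close>-Eichler, and its Eichler quotient in \<open>S\<close> would exceed \<open>H\<close>.\<close>

lemma minimal_not_S_eichler_MNEC:
  fixes Q :: "nat monoid"
  assumes S: "\<And>H. H \<in> S \<Longrightarrow> finite_grp H \<and> eichler_simple H" and cl: "closed_under_quotients S"
    and ne: "S \<noteq> {}" and Q: "finite_grp Q" "\<not> S_eichler S Q"
    and min: "\<And>Q' :: nat monoid. finite_grp Q' \<Longrightarrow> Q \<twoheadrightarrow> Q' \<Longrightarrow> \<not> Q' \<cong> Q \<Longrightarrow> S_eichler S Q'"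
  shows "\<exists>H\<in>S. Q \<in> MNEC H - S"
proof -
  have "\<exists>H. (H \<in> S \<and> Q \<twoheadrightarrow> H) \<and> (\<forall>H'. H' \<in> S \<and> Q \<twoheadrightarrow> H' \<longrightarrow> m_quat H' \<le> m_quat H)"
  proof -
    obtain T where "T \<in> S \<and> Q \<twoheadrightarrow> T"
      using trivial_mem_S[OF S cl ne] Q by (auto simp: finite_grp_def)
    then show ?thesis
    proof (rule Lattices_Big.ex_has_greatest_nat)
      show "\<forall>H'. H' \<in> S \<and> Q \<twoheadrightarrow> H' \<longrightarrow> m_quat H' < m_quat Q + 1"
        using S Q(1) m_quat_mono by (auto simp: less_Suc_eq_le)
    qed
  qed
  then obtain H where H: "H \<in> S" "Q \<twoheadrightarrow> H"
    and max: "\<And>H'. H' \<in> S \<Longrightarrow> Q \<twoheadrightarrow> H' \<Longrightarrow> m_quat H' \<le> m_quat H"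
    by blast
  have Hf: "finite_grp H" using S[OF H(1)] by blast
  obtain f where f: "f \<in> epi Q H" using H by (auto simp: has_quotient_def)
  have "non_eichler_cover Q H"
    using H Q by (auto simp: S_eichler_def eichler_quotient_def non_eichler_cover_def)
  moreover have False
    if G': "finite_grp G'" "\<not> G' \<cong> Q" "non_eichler_cover G' H" "g \<in> epi Q G'" for G' :: "nat monoid" and g
  proof -
    have QG': "Q \<twoheadrightarrow> G'" using G'(4) by (rule has_quotient_I)
    have "S_eichler S G'" using G' QG' by (intro min)
    then obtain H'' where H'': "H'' \<in> S" "G' \<twoheadrightarrow> H''" "m_quat G' = m_quat H''"
      by (auto simp: S_eichler_def eichler_quotient_def)
    have "m_quat G' \<le> m_quat H"
      using max[OF H''(1) has_quotient_trans[OF QG' H''(2)]] H''(3) by simp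
    moreover have "m_quat H \<le> m_quat G'"
      using G' Hf by (intro m_quat_mono) (auto simp: non_eichler_cover_def)
    ultimately show False using G'(3) by (simp add: non_eichler_cover_def)
  qed
  ultimately have "Q \<in> MNEC H"
    using Q(1) f unfolding MNEC_def by blast
  moreover have "Q \<notin> S"
    using Q(2) has_quotient_refl[of Q] by (auto simp: S_eichler_def eichler_quotient_def)
  ultimately show ?thesis using H(1) by blast
qed

theorem lemma1p5:
  fixes S :: "nat monoid set" and G :: "'a monoid"
  assumes "\<And>H. H \<in> S \<Longrightarrow> finite_grp H \<and> eichler_simple H"
    and "closed_under_quotients S"
    and "S \<noteq> {}"
    and "finite_grp G"
  shows "S_eichler S G \<longleftrightarrow> \<not> (\<exists>Q \<in> MNEC_class S. G \<twoheadrightarrow> Q)"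
proof
  assume "S_eichler S G"
  then show "\<not> (\<exists>Q \<in> MNEC_class S. G \<twoheadrightarrow> Q)"
    using S_eichler_no_MNEC_quotient[OF assms(1,2,4)] by (auto simp: MNEC_class_def)
next
  assume no: "\<not> (\<exists>Q \<in> MNEC_class S. G \<twoheadrightarrow> Q)"
  show "S_eichler S G"
  proof (rule ccontr)
    assume nG: "\<not> S_eichler S G"
    \<comment> \<open>The smallest quotient is sought among groups on \<open>nat\<close>, so \<open>G\<close> itself enters through a copy \<open>G'\<close>.\<close>
    define bad where "bad Q \<longleftrightarrow> finite_grp Q \<and> G \<twoheadrightarrow> Q \<and> \<not> S_eichler S Q" for Q :: "nat monoid"
    obtain G' :: "nat monoid" and h where G': "finite_grp G'" and h: "h \<in> iso G G'"
      by (rule finite_grp_nat_copy[OF assms(4)])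
    have GG': "G \<cong> G'" using h by (auto simp: is_iso_def)
    have quot: "G \<twoheadrightarrow> G'" by (rule iso_imp_has_quotient[OF GG'])
    have "bad G'"
      using nG G' quot m_quat_cong[OF assms(4) G' GG'] has_quotient_trans[OF quot]
      by (auto simp: bad_def S_eichler_def eichler_quotient_def)
    then obtain Q where Q: "bad Q"
      and Qmin: "\<And>Q'. bad Q' \<Longrightarrow> card (carrier Q) \<le> card (carrier Q')"
      using ex_has_least_nat[of bad G' "\<lambda>Q. card (carrier Q)"] by blast
    have Qf: "finite_grp Q" and GQ: "G \<twoheadrightarrow> Q" and nQ: "\<not> S_eichler S Q"
      using Q by (auto simp: bad_def)
    have proper: "S_eichler S Q'" if Q': "finite_grp Q'" "Q \<twoheadrightarrow> Q'" "\<not> Q \<cong> Q'" for Q' :: "nat monoid"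
    proof (rule ccontr)
      assume "\<not> S_eichler S Q'"
      then have "bad Q'" using Q'(1) has_quotient_trans[OF GQ Q'(2)] by (simp add: bad_def)
      then have "Q \<cong> Q'" using Q' Qf Qmin by (intro quotient_same_card_iso)
      then show False using Q'(3) by simp
    qed
    have "\<exists>H\<in>S. Q \<in> MNEC H - S"
    proof (rule minimal_not_S_eichler_MNEC[OF assms(1-3) Qf nQ])
      fix Q' :: "nat monoid" assume Q': "finite_grp Q'" "Q \<twoheadrightarrow> Q'" "\<not> Q' \<cong> Q"
      then have "\<not> Q \<cong> Q'" using Qf group.iso_sym by (auto simp: finite_grp_def)
      with Q' show "S_eichler S Q'" by (intro proper)
    qed
    moreover have "Q \<cong> Q'" if Q': "Q \<twoheadrightarrow> Q'" "H' \<in> S" "Q' \<in> MNEC H' - S" for Q' H'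
    proof (rule ccontr)
      assume nonisomorphic: "\<not> Q \<cong> Q'"
      have Q'f: "finite_grp Q'" using Q'(3) by (simp add: MNEC_def)
      have "Q' \<in> MNEC H'" using Q'(3) by blast
      then have "Q' \<in> S"
        using S_eichler_no_MNEC_quotient[OF assms(1,2) Q'f proper[OF Q'f Q'(1) nonisomorphic]]
          Q'(2) has_quotient_refl by blast
      then show False using Q'(3) by blast
    qed
    ultimately have "Q \<in> MNEC_class S" by (auto simp: MNEC_class_def)
    then show False using no GQ by blast
  qed
qed

end
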